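(* Let $X_1, X_2, \ldots$ be independent and identically distributed copies of a random element $X$ of $\mathbb{H}=L^2([0,1],\mathbb{R})$ satisfying $\mathbb{E}\|X\|_{\mathbb{H}}^2<\infty$. Let $\varphi_X(f)=\mathbb{E}[\exp(\mathrm{i}\langle X,f\rangle)]$, $f\in\mathbb{H}$, be the characteristic functional of $X$, and let $\mu$ and $\mathcal{C}$ denote the expectation and the covariance operator of $X$, respectively. Then, as $n\to\infty$, $$T_n \longrightarrow \tau_Q = \int_{\mathbb{H}} \left|\varphi_X(f)-\varphi(f;\mu,\mathcal{C})\right|^2\, Q(\mathrm{d}f)\quad\text{almost surely.}$$
   Context: $\mathbb{H}=L^2([0,1],\mathbb{R})$ is the separable Hilbert space of (equivalence classes of) square-integrable real functions on $[0,1]$, with inner product $\langle f,g\rangle=\int_0^1 f(t)g(t)\,\mathrm{d}t$, norm $\|f\|_{\mathbb{H}}=\langle f,f\rangle^{1/2}$, and Borel $\sigma$-algebra. $Q$ is a fixed Borel probability measure on $\mathbb{H}$ that is symmetric, i.e. invariant under the map $x\mapsto -x$. For a random element $X$ of $\mathbb{H}$ with $\mathbb{E}\|X\|_{\mathbb{H}}^2<\infty$, the expectation $\mu=\mathbb{E}(X)\in\mathbb{H}$ is the unique element with $\mathbb{E}\langle X,x\rangle=\langle\mu,x\rangle$ for all $x\in\mathbb{H}$, and the covariance operator $\mathcal{C}:\mathbb{H}\to\mathbb{H}$ is $\mathcal{C}f=\mathbb{E}(\langle X-\mu,f\rangle X)$, equivalently $\mathcal{C}f(s)=\int_0^1 c(s,t)f(t)\,\mathrm{d}t$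 with $c(s,t)=\mathbb{E}[\{X(s)-\mu(s)\}\{X(t)-\mu(t)\}]$. For $m\in\mathbb{H}$ and a positive symmetric trace-class operator $\mathcal{K}$ on $\mathbb{H}$, put $\varphi(f;m,\mathcal{K})=\exp\left(\mathrm{i}\langle m,f\rangle-\frac12\langle\mathcal{K}f,f\rangle\right)$, $f\in\mathbb{H}$. Given $X_1,\ldots,X_n$, let $\overline{X}_n=\frac1n\sum_{j=1}^n X_j$, let $\mathcal{C}_n$ be the sample covariance operator $\mathcal{C}_nf(s)=\int_0^1 c_n(s,t)f(t)\,\mathrm{d}t$ with $c_n(s,t)=\frac1n\sum_{j=1}^n\{X_j(s)-\overline{X}_n(s)\}\{X_j(t)-\overline{X}_n(t)\}$, let $\varphi_n(f)=\frac1n\sum_{j=1}^n\exp(\mathrm{i}\langle f,X_j\rangle)$ be the empirical characteristic functional, and define $$T_n=\int_{\mathbb{H}}\left|\varphi_n(f)-\varphi(f;\overline{X}_n,\mathcal{C}_n)\right|^2\,Q(\mathrm{d}f).$$ *)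

theory Defs
  imports "HOL-Probability.Probability"
begin

abbreviation unit_leb :: "real measure" where
  "unit_leb \<equiv> lebesgue_on {0..1}"

definition sq_integrable :: "(real \<Rightarrow> real) \<Rightarrow> bool" where
  "sq_integrable f \<longleftrightarrow>
     f \<in> borel_measurable unit_leb \<and> integrable unit_leb (\<lambda>t. (f t)\<^sup>2)"

lemma sq_integrable_mult:
  assumes "sq_integrable f" "sq_integrable g"
  shows "integrable unit_leb (\<lambda>t. f t * g t)"
proof (rule Bochner_Integration.integrable_bound)
  show "integrable unit_leb (\<lambda>t. (f t)\<^sup>2 + (g t)\<^sup>2)"
    using assms by (auto simp: sq_integrable_def)
  show "(\<lambda>t. f t * g t) \<in> borel_measurable unit_leb"
    using assms by (auto simp: sq_integrable_def)
  have "\<bar>a * b\<bar> \<le> a\<^sup>2 + b\<^sup>2" for a b :: real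
  proof -
    have "2 * (\<bar>a\<bar> * \<bar>b\<bar>) \<le> a\<^sup>2 + b\<^sup>2"
      using sum_squares_bound[of "\<bar>a\<bar>" "\<bar>b\<bar>"] by simp
    moreover have "0 \<le> \<bar>a\<bar> * \<bar>b\<bar>" by simp
    ultimately show ?thesis unfolding abs_mult by linarith
  qed
  then show "AE t in unit_leb. norm (f t * g t) \<le> norm ((f t)\<^sup>2 + (g t)\<^sup>2)"
    by simp
qed

lemma sq_integrable_zero: "sq_integrable (\<lambda>_. 0)"
  by (simp add: sq_integrable_def)

lemma sq_integrable_add:
  assumes "sq_integrable f" "sq_integrable g"
  shows "sq_integrable (\<lambda>t. f t + g t)"
proof -
  have "integrable unit_leb (\<lambda>t. (f t)\<^sup>2 + (g t)\<^sup>2 + 2 * (f t * g t))"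
    using assms sq_integrable_mult[OF assms] by (auto simp: sq_integrable_def)
  then show ?thesis
    using assms by (auto simp: sq_integrable_def power2_sum mult.assoc)
qed

lemma sq_integrable_scale:
  assumes "sq_integrable f"
  shows "sq_integrable (\<lambda>t. r * f t)"
  using assms by (auto simp: sq_integrable_def power_mult_distrib)

lemma sq_integrable_uminus:
  assumes "sq_integrable f"
  shows "sq_integrable (\<lambda>t. - f t)"
  using sq_integrable_scale[OF assms, of "-1"] by simp

lemma sq_integrable_diff:
  assumes "sq_integrable f" "sq_integrable g"
  shows "sq_integrable (\<lambda>t. f t - g t)"
  using sq_integrable_add[OF assms(1) sq_integrable_uminus[OF assms(2)]] by simp

definition l2_rel :: "(real \<Rightarrow> real) \<Rightarrow> (real \<Rightarrow> real) \<Rightarrow> bool" where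
  "l2_rel f g \<longleftrightarrow> sq_integrable f \<and> sq_integrable g \<and> (AE t in unit_leb. f t = g t)"

lemma part_equivp_l2_rel: "part_equivp l2_rel"
proof (rule part_equivpI)
  show "\<exists>f. l2_rel f f"
    by (rule exI[of _ "\<lambda>_. 0"]) (simp add: l2_rel_def sq_integrable_zero)
  show "symp l2_rel"
    by (rule sympI) (auto simp: l2_rel_def elim: AE_mp)
  show "transp l2_rel"
  proof (rule transpI)
    fix f g h
    assume fg: "l2_rel f g" and gh: "l2_rel g h"
    have "AE t in unit_leb. f t = g t" "AE t in unit_leb. g t = h t"
      using fg gh by (auto simp: l2_rel_def)
    then have "AE t in unit_leb. f t = h t"
      by eventually_elim simp
    then show "l2_rel f h"
      using fg gh by (simp add: l2_rel_def)
  qed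
qed

text \<open>The Hilbert space of square-integrable real functions on the unit interval, as classes modulo
  equality almost everywhere; \<open>l2_fun\<close> picks a representative.\<close>

quotient_type l2 = "real \<Rightarrow> real" / partial: l2_rel
  morphisms l2_fun l2_class
  by (rule part_equivp_l2_rel)

instantiation l2 :: real_inner
begin

lift_definition zero_l2 :: l2 is "\<lambda>_. 0"
  by (simp add: l2_rel_def sq_integrable_zero)

lift_definition plus_l2 :: "l2 \<Rightarrow> l2 \<Rightarrow> l2" is "\<lambda>f g t. f t + g t"
  unfolding l2_rel_def by (auto intro: sq_integrable_add)

lift_definition minus_l2 :: "l2 \<Rightarrow> l2 \<Rightarrow> l2" is "\<lambda>f g t. f t - g t"
  unfolding l2_rel_def by (auto intro: sq_integrable_diff)

lift_definition uminus_l2 :: "l2 \<Rightarrow> l2" is "\<lambda>f t. - f t"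
  unfolding l2_rel_def by (auto intro: sq_integrable_uminus)

lift_definition scaleR_l2 :: "real \<Rightarrow> l2 \<Rightarrow> l2" is "\<lambda>r f t. r * f t"
  unfolding l2_rel_def by (auto intro: sq_integrable_scale)

lift_definition inner_l2 :: "l2 \<Rightarrow> l2 \<Rightarrow> real" is "\<lambda>f g. LINT t|unit_leb. f t * g t"
  subgoal for f f' g g'
    unfolding l2_rel_def sq_integrable_def
    by (intro integral_cong_AE) auto
  done

definition norm_l2 :: "l2 \<Rightarrow> real" where
  "norm_l2 f = sqrt (inner f f)"

definition sgn_l2 :: "l2 \<Rightarrow> l2" where
  "sgn_l2 f = inverse (norm f) *\<^sub>R f"

definition dist_l2 :: "l2 \<Rightarrow> l2 \<Rightarrow> real" where
  "dist_l2 f g = norm (f - g)"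

definition uniformity_l2 :: "(l2 \<times> l2) filter" where
  "uniformity_l2 = (INF e\<in>{0<..}. principal {(f, g). dist f g < e})"

definition open_l2 :: "l2 set \<Rightarrow> bool" where
  "open_l2 U \<longleftrightarrow> (\<forall>f\<in>U. \<forall>\<^sub>F (f', g) in uniformity. f' = f \<longrightarrow> g \<in> U)"

instance
proof
  fix x y z :: l2 and a b :: real
  show "x + y + z = x + (y + z)"
    by transfer (auto simp: l2_rel_def add.assoc intro!: sq_integrable_add)
  show "x + y = y + x"
    by transfer (auto simp: l2_rel_def add.commute intro!: sq_integrable_add)
  show "0 + x = x"
    by transfer (auto simp: l2_rel_def)
  show "- x + x = 0"
    by transfer (auto simp: l2_rel_def sq_integrable_zero)
  show "x - y = x + - y"
    by transfer (auto simp: l2_rel_def intro: sq_integrable_diff)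
  show "a *\<^sub>R (x + y) = a *\<^sub>R x + a *\<^sub>R y"
    by transfer (auto simp: l2_rel_def distrib_left intro!: sq_integrable_add sq_integrable_scale)
  show "(a + b) *\<^sub>R x = a *\<^sub>R x + b *\<^sub>R x"
    by transfer (auto simp: l2_rel_def distrib_right intro!: sq_integrable_add sq_integrable_scale)
  show "a *\<^sub>R b *\<^sub>R x = (a * b) *\<^sub>R x"
    by transfer (auto simp: l2_rel_def mult.assoc intro!: sq_integrable_scale)
  show "1 *\<^sub>R x = x"
    by transfer (auto simp: l2_rel_def)
  show "inner x y = inner y x"
    by transfer (simp add: mult.commute)
  show "inner (x + y) z = inner x z + inner y z"
    by transfer (auto simp: l2_rel_def distrib_right sq_integrable_mult)
  show "inner (a *\<^sub>R x) y = a * inner x y"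
    by transfer (auto simp: l2_rel_def mult.assoc)
  show "0 \<le> inner x x"
    by transfer simp
  show "(inner x x = 0) = (x = 0)"
  proof transfer
    fix f :: "real \<Rightarrow> real"
    assume "l2_rel f f"
    then have f: "sq_integrable f" by (simp add: l2_rel_def)
    have "(LINT t|unit_leb. f t * f t) = 0 \<longleftrightarrow> (AE t in unit_leb. f t * f t = 0)"
      by (rule integral_nonneg_eq_0_iff_AE) (auto intro: sq_integrable_mult f)
    then show "(LINT t|unit_leb. f t * f t) = 0 \<longleftrightarrow> l2_rel f (\<lambda>_. 0)"
      using f by (simp add: l2_rel_def sq_integrable_zero)
  qed
qed (simp_all only: norm_l2_def sgn_l2_def dist_l2_def uniformity_l2_def open_l2_def)

end

text \<open>The weak (Pettis) expectation. The element exists and is unique whenever the norm of \<open>X\<close> is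
  integrable.\<close>

definition mean_element :: "'w measure \<Rightarrow> ('w \<Rightarrow> l2) \<Rightarrow> l2" where
  "mean_element M X = (THE m. \<forall>x. (LINT \<omega>|M. inner (X \<omega>) x) = inner m x)"

definition cov_operator :: "'w measure \<Rightarrow> ('w \<Rightarrow> l2) \<Rightarrow> l2 \<Rightarrow> l2" where
  "cov_operator M X f =
     mean_element M (\<lambda>\<omega>. inner (X \<omega> - mean_element M X) f *\<^sub>R X \<omega>)"

definition char_functional :: "'w measure \<Rightarrow> ('w \<Rightarrow> l2) \<Rightarrow> l2 \<Rightarrow> complex" where
  "char_functional M X f = (LINT \<omega>|M. exp (\<i> * complex_of_real (inner (X \<omega>) f)))"

text \<open>This is the characteristic functional of a Gaussian element when \<open>K\<close> is positive, symmetric and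
  trace class; the formula itself makes sense for every \<open>K\<close>.\<close>

definition gauss_functional :: "l2 \<Rightarrow> l2 \<Rightarrow> (l2 \<Rightarrow> l2) \<Rightarrow> complex" where
  "gauss_functional f m K =
     exp (\<i> * complex_of_real (inner m f) - complex_of_real (inner (K f) f) / 2)"

text \<open>A sample of size \<open>n\<close> consists of the entries \<open>x 1, \<dots>, x n\<close> of a sequence \<open>x\<close>.\<close>

definition sample_mean :: "nat \<Rightarrow> (nat \<Rightarrow> l2) \<Rightarrow> l2" where
  "sample_mean n x = (1 / real n) *\<^sub>R (\<Sum>j=1..n. x j)"

definition sample_cov_kernel :: "nat \<Rightarrow> (nat \<Rightarrow> l2) \<Rightarrow> real \<Rightarrow> real \<Rightarrow> real" where
  "sample_cov_kernel n x s t = (1 / real n) *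
     (\<Sum>j=1..n. (l2_fun (x j) s - l2_fun (sample_mean n x) s) *
                (l2_fun (x j) t - l2_fun (sample_mean n x) t))"

text \<open>The kernel is built from arbitrary representatives; the class of the resulting function does
  not depend on them.\<close>

definition sample_cov_operator :: "nat \<Rightarrow> (nat \<Rightarrow> l2) \<Rightarrow> l2 \<Rightarrow> l2" where
  "sample_cov_operator n x f =
     l2_class (\<lambda>s. LINT t|unit_leb. sample_cov_kernel n x s t * l2_fun f t)"

definition emp_char_functional :: "nat \<Rightarrow> (nat \<Rightarrow> l2) \<Rightarrow> l2 \<Rightarrow> complex" where
  "emp_char_functional n x f =
     (1 / of_nat n) * (\<Sum>j=1..n. exp (\<i> * complex_of_real (inner f (x j))))"

definition T_stat :: "l2 measure \<Rightarrow> nat \<Rightarrow> (nat \<Rightarrow> l2) \<Rightarrow> real" where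
  "T_stat Q n x =
     (LINT f|Q. (cmod (emp_char_functional n x f
        - gauss_functional f (sample_mean n x) (sample_cov_operator n x)))\<^sup>2)"

definition tau :: "l2 measure \<Rightarrow> 'w measure \<Rightarrow> ('w \<Rightarrow> l2) \<Rightarrow> real" where
  "tau Q M X =
     (LINT f|Q. (cmod (char_functional M X f
        - gauss_functional f (mean_element M X) (cov_operator M X)))\<^sup>2)"

end

theory Submission
  imports Defs
begin

text \<open>For a fixed \<open>f\<close> the integrand of \<open>T\<^sub>n\<close> depends on the sample only through the averages of
  \<open>cos\<close>, \<open>sin\<close>, the identity and the square at the real numbers \<open>\<langle>X\<^sub>j, f\<rangle>\<close>, since
  \<open>\<langle>C\<^sub>n f, f\<rangle>\<close> is the empirical variance of these numbers. By the scalar strong law of large numbers it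
  converges almost surely to the integrand of \<open>\<tau>\<^sub>Q\<close>. As \<open>L\<^sup>2\<close> is separable, the inner product is jointly
  measurable, so Fubini's theorem turns this into: for almost every \<open>\<omega>\<close> the integrands converge
  \<open>Q\<close>-almost everywhere. They are bounded by \<open>4\<close>, so dominated convergence finishes the proof.
  Completeness of \<open>L\<^sup>2\<close> is needed only to identify the weak expectation with a Bochner integral.\<close>

section \<open>The strong law of large numbers for integrable real random variables\<close>

text \<open>The obstacle is that the null set on which the integrands at a fixed \<open>f\<close>
  fail to converge depends on \<open>f\<close>, and uncountably many null sets cannot be united.
  Since \<open>T_stat\<close> only integrates over \<open>Q\<close>, a single null set that serves
  \<open>Q\<close>-almost every \<open>f\<close> suffices, and exchanging the two almost-everywhere
  quantifiers provides it. Among the averaged quantities is the square of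
  \<open>inner (X \<omega>) f\<close>, of which only integrability is known. Sample and population
  are both expressed through one continuous function of four real numbers; once the four averages
  converge, so do the integrands.\<close>

lemma AE_summable_if_integrals_bounded:
  fixes f :: "nat \<Rightarrow> 'a \<Rightarrow> real"
  assumes int: "\<And>n. integrable M (f n)" and nn: "\<And>n x. 0 \<le> f n x"
    and bd: "\<And>N. (\<Sum>n<N. \<integral>x. f n x \<partial>M) \<le> C"
  shows "AE x in M. summable (\<lambda>n. f n x)"
proof -
  have [measurable]: "f n \<in> borel_measurable M" for n
    using int by auto
  have "(\<integral>\<^sup>+x. (\<Sum>n. ennreal (f n x)) \<partial>M) = (\<Sum>n. ennreal (\<integral>x. f n x \<partial>M))"
    by (simp add: nn_integral_suminf nn_integral_eq_integral int nn)
  also have "\<dots> \<le> ennreal C"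
    using bd by (intro suminf_le_const)
      (auto simp: sum_ennreal integral_nonneg_AE nn intro!: ennreal_leI)
  finally have "(\<integral>\<^sup>+x. (\<Sum>n. ennreal (f n x)) \<partial>M) \<noteq> \<infinity>"
    by (metis ennreal_neq_top infinity_ennreal_def top_unique)
  then have "AE x in M. (\<Sum>n. ennreal (f n x)) \<noteq> \<infinity>"
    by (intro nn_integral_PInf_AE) auto
  then show ?thesis
    by eventually_elim (use nn in \<open>auto intro: summable_suminf_not_top\<close>)
qed

text \<open>Bienayme's identity: after centring, the square of the sum is a double sum whose
  off-diagonal terms are products of independent factors of mean zero.\<close>

lemma (in prob_space) variance_sum_indep:
  fixes W :: "'i \<Rightarrow> 'a \<Rightarrow> real"
  assumes fin: "finite I" and ind: "indep_vars (\<lambda>_. borel) W I"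
    and sq: "\<And>i. i \<in> I \<Longrightarrow> integrable M (\<lambda>x. (W i x)\<^sup>2)"
  shows "integrable M (\<lambda>x. ((\<Sum>i\<in>I. W i x) - expectation (\<lambda>x. \<Sum>i\<in>I. W i x))\<^sup>2)"
    and "variance (\<lambda>x. \<Sum>i\<in>I. W i x) = (\<Sum>i\<in>I. variance (W i))"
proof -
  have [measurable]: "W i \<in> borel_measurable M" if "i \<in> I" for i
    using ind that by (auto simp: indep_vars_def)
  have int: "integrable M (W i)" if "i \<in> I" for i
    by (rule square_integrable_imp_integrable[OF _ sq]) (use that in auto)
  define V where "V i x = W i x - expectation (W i)" for i x
  have intV: "integrable M (V i)" and EV: "expectation (V i) = 0" if "i \<in> I" for i
    using int[OF that] unfolding V_def by (auto simp: prob_space)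
  have indV: "indep_vars (\<lambda>_. borel) V I"
    unfolding V_def by (rule indep_vars_compose2[OF ind, where Y="\<lambda>i y. y - expectation (W i)"]) auto
  have sqV: "integrable M (\<lambda>x. V i x * V i x)" if "i \<in> I" for i
  proof -
    have "integrable M (\<lambda>x. (W i x)\<^sup>2 - 2 * expectation (W i) * W i x + (expectation (W i))\<^sup>2)"
      using int sq that by auto
    then show ?thesis
      unfolding V_def by (simp add: power2_eq_square algebra_simps)
  qed
  have off: "integrable M (\<lambda>x. V i x * V j x)" "expectation (\<lambda>x. V i x * V j x) = 0"
    if "i \<in> I" "j \<in> I" "i \<noteq> j" for i j
  proof -
    have "indep_vars (\<lambda>_. borel) V {i, j}"
      by (rule indep_vars_subset[OF indV]) (use that in auto)
    from indep_vars_integrable[OF _ this] indep_vars_lebesgue_integral[OF _ this]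
    show "integrable M (\<lambda>x. V i x * V j x)" "expectation (\<lambda>x. V i x * V j x) = 0"
      using that intV EV by (force, force)
  qed
  have intVV: "integrable M (\<lambda>x. V i x * V j x)" if "i \<in> I" "j \<in> I" for i j
    using sqV off that by (cases "i = j") auto
  have eq: "((\<Sum>i\<in>I. W i x) - expectation (\<lambda>x. \<Sum>i\<in>I. W i x))\<^sup>2
      = (\<Sum>i\<in>I. \<Sum>j\<in>I. V i x * V j x)" for x
    using int by (simp add: V_def sum_subtractf[symmetric] power2_eq_square sum_product)
  show "integrable M (\<lambda>x. ((\<Sum>i\<in>I. W i x) - expectation (\<lambda>x. \<Sum>i\<in>I. W i x))\<^sup>2)"
    unfolding eq using intVV by auto
  have "variance (\<lambda>x. \<Sum>i\<in>I. W i x) = (\<Sum>i\<in>I. \<Sum>j\<in>I. expectation (\<lambda>x. V i x * V j x))"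
    unfolding eq using intVV by (simp add: Bochner_Integration.integral_sum)
  also have "\<dots> = (\<Sum>i\<in>I. \<Sum>j\<in>I. if i = j then variance (W i) else 0)"
    by (intro sum.cong refl) (auto simp: off, simp add: V_def power2_eq_square)
  also have "\<dots> = (\<Sum>i\<in>I. variance (W i))"
    using fin by simp
  finally show "variance (\<lambda>x. \<Sum>i\<in>I. W i x) = (\<Sum>i\<in>I. variance (W i))" .
qed

text \<open>A geometric sum is at most \<open>a / (a - 1)\<close> times its largest term, here a
  power below \<open>y\<close>. Taken at \<open>y = Y 0 x\<close>, it controls the expected number
  of truncated terms.\<close>

lemma sum_powers_below:
  fixes a y :: real
  assumes a: "1 < a" and y: "0 \<le> y"
  shows "(\<Sum>n<N. if a ^ n < y then a ^ n else 0) \<le> a / (a - 1) * y"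
proof (induction N)
  case 0
  then show ?case using a y by simp
next
  case (Suc N)
  show ?case
  proof (cases "a ^ N < y")
    case True
    have "(\<Sum>n<Suc N. if a ^ n < y then a ^ n else 0) \<le> (\<Sum>n<Suc N. a ^ n)"
      using a by (intro sum_mono) auto
    also have "\<dots> = (a ^ Suc N - 1) / (a - 1)"
      using a by (intro geometric_sum) auto
    also have "\<dots> \<le> a / (a - 1) * a ^ N"
      using a by (simp add: divide_right_mono)
    also have "\<dots> \<le> a / (a - 1) * y"
      using a True by (intro mult_left_mono) auto
    finally show ?thesis .
  qed (use Suc in simp)
qed

text \<open>The nonzero terms form a geometric sum starting at the first power \<open>a ^ m\<close>
  not below \<open>y\<close>, where \<open>y\<^sup>2 / a ^ m \<le> y\<close>. Taken at
  \<open>y = Y 0 x\<close>, it controls the variances of the truncated averages.\<close>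

lemma sum_inverse_powers_above:
  fixes a y :: real
  assumes a: "1 < a" and y: "0 \<le> y"
  shows "(\<Sum>n<N. if y \<le> a ^ n then y\<^sup>2 / a ^ n else 0) \<le> a / (a - 1) * y"
proof -
  \<comment> \<open>The starting index is generalised so that the induction can discard vanishing
    leading terms until the powers reach \<open>y\<close>.\<close>
  have "(\<Sum>n=m..<m+d. if y \<le> a ^ n then y\<^sup>2 / a ^ n else 0) \<le> a / (a - 1) * y" for m d
  proof (induction d arbitrary: m)
    case 0
    then show ?case using a y by simp
  next
    case (Suc d)
    show ?case
    proof (cases "y \<le> a ^ m")
      case True
      have "(\<Sum>n=m..<m+Suc d. if y \<le> a ^ n then y\<^sup>2 / a ^ n else 0) \<le> (\<Sum>n=m..<m+Suc d. y\<^sup>2 / a ^ n)"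
        using a by (intro sum_mono) auto
      also have "\<dots> = (y\<^sup>2 / a ^ m) * (\<Sum>n<Suc d. (1 / a) ^ n)"
        using sum.shift_bounds_nat_ivl[of "\<lambda>n. y\<^sup>2 / a ^ n" 0 m "Suc d"]
        by (simp add: sum_distrib_left power_add power_divide atLeast0LessThan add.commute mult.commute del: sum.lessThan_Suc sum.op_ivl_Suc)
      also have "\<dots> \<le> (y\<^sup>2 / a ^ m) * (a / (a - 1))"
      proof (rule mult_left_mono)
        have "(\<Sum>n<Suc d. (1 / a) ^ n) \<le> (\<Sum>n. (1 / a) ^ n)"
          using a by (intro sum_le_suminf summable_geometric) auto
        also have "\<dots> = a / (a - 1)"
          using a by (subst suminf_geometric) (auto simp: field_simps)
        finally show "(\<Sum>n<Suc d. (1 / a) ^ n) \<le> a / (a - 1)" .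
      qed (use a in simp)
      also have "\<dots> \<le> y * (a / (a - 1))"
      proof (rule mult_right_mono)
        show "y\<^sup>2 / a ^ m \<le> y"
          using a y True by (simp add: field_simps power2_eq_square mult_left_mono)
      qed (use a in simp)
      finally show ?thesis by (simp add: mult.commute)
    next
      case False
      then have "(\<Sum>n=m..<m+Suc d. if y \<le> a ^ n then y\<^sup>2 / a ^ n else 0)
          = (\<Sum>n=Suc m..<Suc m+d. if y \<le> a ^ n then y\<^sup>2 / a ^ n else 0)"
        by (subst sum.atLeast_Suc_lessThan) (simp_all del: sum.op_ivl_Suc)
      then show ?thesis
        using Suc[of "Suc m"] by simp
    qed
  qed
  from this[of 0 N] show ?thesis by (simp add: atLeast0LessThan)
qed

text \<open>For \<open>k n \<le> N \<le> k (Suc n)\<close>, monotonicity puts \<open>S N / N\<close>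
  between \<open>S (k n) / k (Suc n)\<close> and \<open>S (k (Suc n)) / k n\<close>. These tend to
  \<open>m / a\<close> and \<open>m * a\<close>, which are close to \<open>m\<close> when the ratio
  \<open>a\<close> is close to 1. Only countably many ratios are used, so that an almost sure
  version can unite the null sets.\<close>

lemma averages_converge_from_geometric_subsequences:
  fixes S :: "nat \<Rightarrow> real"
  assumes mono: "mono S" and nn: "\<And>n. 0 \<le> S n"
    and sub: "\<And>p. (\<lambda>n. S (nat \<lceil>(1 + 1 / Suc p) ^ n\<rceil>) / nat \<lceil>(1 + 1 / Suc p) ^ n\<rceil>) \<longlonglongrightarrow> m"
  shows "(\<lambda>n. S n / n) \<longlonglongrightarrow> m"
proof -
  have m: "0 \<le> m"
    by (rule LIMSEQ_le_const[OF sub[of 0]]) (auto intro!: divide_nonneg_nonneg nn)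
  show ?thesis
  proof (rule LIMSEQ_I)
    fix e :: real assume e: "0 < e"
    have lim1: "(\<lambda>p. m * (1 + 1 / real (Suc p))) \<longlonglongrightarrow> m * (1 + 0)"
      by (intro tendsto_intros lim_1_over_n[THEN LIMSEQ_Suc])
    have lim2: "(\<lambda>p. m / (1 + 1 / real (Suc p))) \<longlonglongrightarrow> m / (1 + 0)"
      by (intro tendsto_intros lim_1_over_n[THEN LIMSEQ_Suc]) auto
    have "\<forall>\<^sub>F p in sequentially. m * (1 + 1 / real (Suc p)) < m + e \<and> m - e < m / (1 + 1 / real (Suc p))"
      using order_tendstoD(2)[OF lim1, of "m + e"] order_tendstoD(1)[OF lim2, of "m - e"] e
      by (auto intro: eventually_conj)
    then obtain p where p: "m * (1 + 1 / real (Suc p)) < m + e" "m - e < m / (1 + 1 / real (Suc p))"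
      by (auto simp: eventually_sequentially)
    define a where "a = 1 + 1 / real (Suc p)"
    define k where "k n = nat \<lceil>a ^ n\<rceil>" for n
    define A where "A n = S (k n) / k n" for n
    have a: "1 < a" by (simp add: a_def)
    have k_ge: "a ^ n \<le> k n" and k_le: "k n \<le> a ^ n + 1" for n
    proof -
      show "a ^ n \<le> k n" by (simp add: k_def real_nat_ceiling_ge)
      have "1 \<le> a ^ n" using a by simp
      then show "k n \<le> a ^ n + 1" unfolding k_def by linarith
    qed
    have k_pos: "0 < real (k n)" for n
      using k_ge[of n] a by (meson less_le_trans zero_less_power zero_less_one less_trans)
    have A: "A \<longlonglongrightarrow> m"
      using sub[of p] by (simp add: A_def[abs_def] k_def a_def)
    have A_nn: "0 \<le> A n" for n
      by (simp add: A_def nn)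
    \<comment> \<open>This bounds \<open>k (Suc n) / k n\<close>: rounding up adds at most 1 to the
      numerator \<open>a ^ Suc n\<close>, and the denominator is at least
      \<open>a ^ n\<close>.\<close>
    define q where "q n = a + (1 / a) ^ n" for n
    have q: "q \<longlonglongrightarrow> a + 0"
      unfolding q_def using a by (intro tendsto_intros LIMSEQ_power_zero) auto
    have q_pos: "0 < q n" for n
      using a by (simp add: q_def add_pos_pos)
    have ratio: "real (k (Suc n)) \<le> q n * k n" for n
    proof -
      have "real (k (Suc n)) \<le> q n * a ^ n"
        using k_le[of "Suc n"] a by (simp add: q_def algebra_simps power_divide)
      also have "\<dots> \<le> q n * k n"
        using k_ge[of n] q_pos[of n] by (intro mult_left_mono) auto
      finally show ?thesis .
    qed
    have "(\<lambda>n. A (Suc n) * q n) \<longlonglongrightarrow> m * (a + 0)" "(\<lambda>n. A n / q n) \<longlonglongrightarrow> m / (a + 0)"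
      using a by (intro tendsto_intros A q LIMSEQ_Suc[OF A]; simp)+
    then have "\<forall>\<^sub>F n in sequentially. A (Suc n) * q n < m + e \<and> m - e < A n / q n"
      using p by (intro eventually_conj) (auto simp: a_def dest: order_tendstoD)
    then obtain n0 where n0: "\<And>n. n0 \<le> n \<Longrightarrow> A (Suc n) * q n < m + e \<and> m - e < A n / q n"
      by (auto simp: eventually_sequentially)
    show "\<exists>N0. \<forall>N\<ge>N0. norm (S N / real N - m) < e"
    proof (intro exI allI impI)
      fix N assume N: "k n0 \<le> N"
      have "\<exists>n. real N < a ^ Suc n"
        using real_arch_pow[OF a, of "real N"] a
        by (metis less_trans lessI power_strict_increasing_iff)
      \<comment> \<open>Minimality gives \<open>a ^ n \<le> N\<close> when \<open>n\<close> is
        positive; for \<open>n = 0\<close> it holds because \<open>N\<close> is at least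
        \<open>k n0\<close>, hence at least 1.\<close>
      then obtain n where n: "real N < a ^ Suc n" and least: "\<And>i. i < n \<Longrightarrow> \<not> real N < a ^ Suc i"
        using exists_least_iff[of "\<lambda>n. real N < a ^ Suc n"] by blast
      have aN: "a ^ n \<le> N"
      proof (cases n)
        case 0
        have "0 < real N" using N k_pos[of n0] by linarith
        then show ?thesis using 0 by simp
      next
        case (Suc i)
        then show ?thesis using least[of i] by simp
      qed
      have kN: "k n \<le> N" "N \<le> k (Suc n)"
        using aN n k_ge[of "Suc n"] by (simp add: k_def nat_le_iff ceiling_le_iff, linarith)
      have "a ^ n0 < a ^ Suc n"
        using k_ge[of n0] N n by linarith
      then have "n0 < Suc n" using a by (simp add: power_strict_increasing_iff del: power_Suc)
      then have bounds: "A (Suc n) * q n < m + e" "m - e < A n / q n"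
        using n0[of n] by auto
      have Npos: "0 < real N" using kN(1) k_pos[of n] by linarith
      have "S N / N \<le> S (k (Suc n)) / k n"
        using kN k_pos[of n] Npos nn by (intro frac_le monoD[OF mono]) auto
      also have "\<dots> = A (Suc n) * (k (Suc n) / k n)"
        using k_pos[of "Suc n"] by (simp add: A_def)
      also have "\<dots> \<le> A (Suc n) * q n"
        using ratio[of n] k_pos[of n] A_nn by (intro mult_left_mono) (auto simp: field_simps)
      finally have up: "S N / N < m + e" using bounds by simp
      have "A n / q n \<le> A n / (k (Suc n) / k n)"
        using ratio[of n] k_pos[of n] k_pos[of "Suc n"] A_nn q_pos[of n]
        by (intro divide_left_mono) (auto simp: field_simps)
      also have "\<dots> = S (k n) / k (Suc n)"
        using k_pos[of n] by (simp add: A_def)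
      also have "\<dots> \<le> S N / N"
        using kN Npos nn by (intro frac_le monoD[OF mono]) auto
      finally have "m - e < S N / N" using bounds by simp
      with up show "norm (S N / real N - m) < e" by (simp add: abs_less_iff)
    qed
  qed
qed

section \<open>The strong law along geometric subsequences, then along all indices\<close>

context prob_space
begin

lemma expectation_eq_if_distr_eq:
  fixes Y :: "nat \<Rightarrow> 'a \<Rightarrow> 'c::topological_space" and g :: "'c \<Rightarrow> real"
  assumes "Y n \<in> borel_measurable M" "Y 0 \<in> borel_measurable M" "g \<in> borel_measurable borel"
    and "distr M borel (Y n) = distr M borel (Y 0)"
  shows "integrable M (\<lambda>x. g (Y n x)) \<longleftrightarrow> integrable M (\<lambda>x. g (Y 0 x))"
    and "expectation (\<lambda>x. g (Y n x)) = expectation (\<lambda>x. g (Y 0 x))"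
  using assms integrable_distr_eq[of "Y n" M borel g] integrable_distr_eq[of "Y 0" M borel g]
    integral_distr[of "Y n" M borel g] integral_distr[of "Y 0" M borel g] by auto

text \<open>Etemadi's method: truncating at \<open>a ^ n\<close> along \<open>k n = nat \<lceil>a ^ n\<rceil>\<close> makes both the variances
  of the truncated averages and the probabilities of truncation summable, by geometric series.\<close>

lemma strong_law_subsequence:
  fixes Y :: "nat \<Rightarrow> 'a \<Rightarrow> real" and a :: real
  assumes ind: "indep_vars (\<lambda>_. borel) Y UNIV" and nn: "\<And>n x. 0 \<le> Y n x"
    and int: "integrable M (Y 0)" and id: "\<And>n. distr M borel (Y n) = distr M borel (Y 0)"
    and a: "1 < a"
  shows "AE x in M. (\<lambda>n. (\<Sum>i<nat \<lceil>a ^ n\<rceil>. Y i x) / nat \<lceil>a ^ n\<rceil>) \<longlonglongrightarrow> expectation (Y 0)"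
proof -
  have meas[measurable]: "Y n \<in> borel_measurable M" for n
    using ind by (auto simp: indep_vars_def)
  define k where "k n = nat \<lceil>a ^ n\<rceil>" for n
  have k_ge: "a ^ n \<le> k n" and k_le: "k n \<le> 2 * a ^ n" for n
  proof -
    show "a ^ n \<le> k n" by (simp add: k_def real_nat_ceiling_ge)
    have "1 \<le> a ^ n" using a by simp
    then show "k n \<le> 2 * a ^ n" unfolding k_def by linarith
  qed
  have k_pos: "0 < real (k n)" for n
    using k_ge[of n] a by (meson less_le_trans zero_less_power zero_less_one less_trans)
  define C where "C = a / (a - 1)"
  \<comment> \<open>The truncation level belongs to the block \<open>n\<close> and not to the index
    \<open>i\<close> of the summand, so all summands of \<open>T n\<close> keep a common
    law.\<close>
  define t :: "nat \<Rightarrow> real \<Rightarrow> real" where "t n y = (if y \<le> a ^ n then y else 0)" for n y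
  have [measurable]: "t n \<in> borel_measurable borel" for n
    unfolding t_def by measurable
  have t_bd: "norm ((t n (Y i x))\<^sup>2) \<le> (a ^ n)\<^sup>2" for n i x
    using nn[of i x] by (auto simp: t_def intro: power_mono)
  have int_sq: "integrable M (\<lambda>x. (t n (Y i x))\<^sup>2)" for n i
    by (rule integrable_const_bound[where B="(a ^ n)\<^sup>2"]) (use t_bd in auto)
  have ind_t: "indep_vars (\<lambda>_. borel) (\<lambda>i x. t n (Y i x)) I" for n I
    by (rule indep_vars_compose2[OF indep_vars_subset[OF ind], where Y="\<lambda>_. t n"]) auto
  define T where "T n x = (\<Sum>i<k n. t n (Y i x))" for n x
  have Et: "expectation (\<lambda>x. t n (Y i x)) = expectation (\<lambda>x. t n (Y 0 x))" for n i
    by (rule expectation_eq_if_distr_eq[where g="t n"]) (auto intro: id)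
  have Et2: "expectation (\<lambda>x. (t n (Y i x))\<^sup>2) = expectation (\<lambda>x. (t n (Y 0 x))\<^sup>2)" for n i
    by (rule expectation_eq_if_distr_eq[where g="\<lambda>y. (t n y)\<^sup>2"]) (auto intro: id)
  have int_t: "integrable M (\<lambda>x. t n (Y i x))" for n i
    by (rule square_integrable_imp_integrable[OF _ int_sq]) auto
  have ET: "expectation (T n) = k n * expectation (\<lambda>x. t n (Y 0 x))" for n
  proof -
    have "expectation (T n) = (\<Sum>i<k n. expectation (\<lambda>x. t n (Y i x)))"
      unfolding T_def by (simp add: Bochner_Integration.integral_sum int_t)
    also have "\<dots> = (\<Sum>i<k n. expectation (\<lambda>x. t n (Y 0 x)))"
      by (intro sum.cong refl Et)
    finally show ?thesis by simp
  qed
  \<comment> \<open>If the expectations of these squared deviations are summable, then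
    \<open>D n x\<close> is summable for almost every \<open>x\<close> and tends to 0; this takes
    the place of Chebyshev with Borel-Cantelli.\<close>
  define D where "D n x = ((T n x - expectation (T n)) / k n)\<^sup>2" for n x
  have intD: "integrable M (D n)" for n
    unfolding D_def T_def power_divide
    using variance_sum_indep(1)[where W="\<lambda>i x. t n (Y i x)" and I="{..<k n}", OF _ ind_t int_sq] by auto
  have ED: "expectation (D n) \<le> expectation (\<lambda>x. (t n (Y 0 x))\<^sup>2 / a ^ n)" for n
  proof -
    have "expectation (D n) = variance (T n) / (k n)\<^sup>2"
      unfolding D_def power_divide by simp
    also have "variance (T n) = (\<Sum>i<k n. variance (\<lambda>x. t n (Y i x)))"
      unfolding T_def by (rule variance_sum_indep(2)[where W="\<lambda>i x. t n (Y i x)" and I="{..<k n}", OF _ ind_t int_sq]) auto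
    also have "\<dots> \<le> (\<Sum>i<k n. expectation (\<lambda>x. (t n (Y 0 x))\<^sup>2))"
    proof (rule sum_mono)
      fix i
      have "variance (\<lambda>x. t n (Y i x)) \<le> expectation (\<lambda>x. (t n (Y i x))\<^sup>2)"
        by (simp add: variance_eq int_t int_sq)
      then show "variance (\<lambda>x. t n (Y i x)) \<le> expectation (\<lambda>x. (t n (Y 0 x))\<^sup>2)"
        by (simp only: Et2[of n i])
    qed
    also have "\<dots> / (k n)\<^sup>2 = expectation (\<lambda>x. (t n (Y 0 x))\<^sup>2) / k n"
      using k_pos[of n] by (simp add: power2_eq_square)
    also have "\<dots> \<le> expectation (\<lambda>x. (t n (Y 0 x))\<^sup>2) / a ^ n"
      using k_ge[of n] a by (intro divide_left_mono mult_pos_pos k_pos) auto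
    finally show ?thesis using k_pos by (simp add: divide_right_mono)
  qed
  have "AE x in M. summable (\<lambda>n. D n x)"
  proof (rule AE_summable_if_integrals_bounded[OF intD])
    fix N
    have "(\<Sum>n<N. expectation (D n)) \<le> (\<Sum>n<N. expectation (\<lambda>x. (t n (Y 0 x))\<^sup>2 / a ^ n))"
      by (intro sum_mono ED)
    also have "\<dots> = expectation (\<lambda>x. \<Sum>n<N. (t n (Y 0 x))\<^sup>2 / a ^ n)"
      by (simp add: Bochner_Integration.integral_sum int_sq)
    also have "\<dots> \<le> expectation (\<lambda>x. C * Y 0 x)"
    proof (rule integral_mono)
      fix x
      have "(\<Sum>n<N. (t n (Y 0 x))\<^sup>2 / a ^ n) = (\<Sum>n<N. if Y 0 x \<le> a ^ n then (Y 0 x)\<^sup>2 / a ^ n else 0)"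
        by (intro sum.cong) (auto simp: t_def)
      also have "\<dots> \<le> C * Y 0 x"
        unfolding C_def by (rule sum_inverse_powers_above[OF a nn])
      finally show "(\<Sum>n<N. (t n (Y 0 x))\<^sup>2 / a ^ n) \<le> C * Y 0 x" .
    qed (use int int_sq in auto)
    finally show "(\<Sum>n<N. expectation (D n)) \<le> expectation (\<lambda>x. C * Y 0 x)" .
  qed (simp add: D_def)
  then have conv_T: "AE x in M. (\<lambda>n. (T n x - expectation (T n)) / k n) \<longlonglongrightarrow> 0"
  proof eventually_elim
    case (elim x)
    from tendsto_real_sqrt[OF summable_LIMSEQ_zero[OF this]]
    have "(\<lambda>n. \<bar>(T n x - expectation (T n)) / k n\<bar>) \<longlonglongrightarrow> 0" by (simp add: D_def)
    then show ?case by (rule tendsto_rabs_zero_cancel)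
  qed
  \<comment> \<open>The number of terms of block \<open>n\<close> that truncation changes. It is a
    sum of zeros and ones, so once it is below 1 nothing is truncated. The factor 2 in the bound on
    its expectation comes from \<open>k n \<le> a ^ n + 1 \<le> 2 * a ^ n\<close>.\<close>
  define J :: "nat \<Rightarrow> 'a \<Rightarrow> real" where "J n x = (\<Sum>i<k n. of_bool (a ^ n < Y i x))" for n x
  have int_bool: "integrable M (\<lambda>x. of_bool (a ^ n < Y i x) :: real)" for n i
    by (rule integrable_const_bound[where B=1]) auto
  have "AE x in M. summable (\<lambda>n. J n x)"
  proof (rule AE_summable_if_integrals_bounded)
    show "integrable M (J n)" for n
      unfolding J_def by (intro Bochner_Integration.integrable_sum int_bool)
    fix N
    have "expectation (J n) \<le> expectation (\<lambda>x. 2 * a ^ n * of_bool (a ^ n < Y 0 x))" for n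
    proof -
      have eq: "expectation (\<lambda>x. of_bool (a ^ n < Y i x)) = expectation (\<lambda>x. of_bool (a ^ n < Y 0 x) :: real)" for i
        by (rule expectation_eq_if_distr_eq[where g="\<lambda>y. of_bool (a ^ n < y)"]) (auto intro: id)
      have "expectation (J n) = (\<Sum>i<k n. expectation (\<lambda>x. of_bool (a ^ n < Y i x)))"
        unfolding J_def by (intro Bochner_Integration.integral_sum int_bool)
      also have "\<dots> = (\<Sum>i<k n. expectation (\<lambda>x. of_bool (a ^ n < Y 0 x)))"
        by (intro sum.cong refl eq)
      also have "\<dots> = k n * expectation (\<lambda>x. of_bool (a ^ n < Y 0 x))" by simp
      also have "\<dots> \<le> 2 * a ^ n * expectation (\<lambda>x. of_bool (a ^ n < Y 0 x))"
        by (intro mult_right_mono k_le integral_nonneg_AE) auto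
      finally show ?thesis by simp
    qed
    then have "(\<Sum>n<N. expectation (J n)) \<le> (\<Sum>n<N. expectation (\<lambda>x. 2 * a ^ n * of_bool (a ^ n < Y 0 x)))"
      by (intro sum_mono)
    also have "\<dots> = expectation (\<lambda>x. \<Sum>n<N. 2 * a ^ n * of_bool (a ^ n < Y 0 x))"
      using int_bool by (intro Bochner_Integration.integral_sum[symmetric]) auto
    also have "\<dots> \<le> expectation (\<lambda>x. 2 * (C * Y 0 x))"
    proof (rule integral_mono)
      fix x
      have "(\<Sum>n<N. 2 * a ^ n * of_bool (a ^ n < Y 0 x)) = 2 * (\<Sum>n<N. if a ^ n < Y 0 x then a ^ n else 0)"
        unfolding sum_distrib_left by (intro sum.cong) auto
      also have "\<dots> \<le> 2 * (C * Y 0 x)"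
        unfolding C_def by (intro mult_left_mono sum_powers_below[OF a nn]) auto
      finally show "(\<Sum>n<N. 2 * a ^ n * of_bool (a ^ n < Y 0 x)) \<le> 2 * (C * Y 0 x)" .
    qed (intro Bochner_Integration.integrable_sum integrable_mult_right int_bool int)+
    finally show "(\<Sum>n<N. expectation (J n)) \<le> expectation (\<lambda>x. 2 * (C * Y 0 x))" .
  qed (auto simp: J_def intro: sum_nonneg)
  then have conv_J: "AE x in M. \<forall>\<^sub>F n in sequentially. T n x = (\<Sum>i<k n. Y i x)"
  proof eventually_elim
    case (elim x)
    have "\<forall>\<^sub>F n in sequentially. J n x < 1"
      using summable_LIMSEQ_zero[OF elim] by (rule order_tendstoD) simp
    then show ?case
    proof eventually_elim
      case (elim n)
      have "Y i x \<le> a ^ n" if "i < k n" for i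
      proof (rule ccontr)
        assume "\<not> Y i x \<le> a ^ n"
        then have "1 = (of_bool (a ^ n < Y i x) :: real)" by simp
        also have "\<dots> \<le> J n x"
          unfolding J_def using that by (intro member_le_sum) auto
        finally show False using elim by simp
      qed
      then show ?case by (simp add: T_def t_def)
    qed
  qed
  \<comment> \<open>So far the averages are centred at truncated means; these still have to be
    replaced by the true one.\<close>
  have lim_t: "(\<lambda>n. expectation (\<lambda>x. t n (Y 0 x))) \<longlonglongrightarrow> expectation (Y 0)"
  proof (rule integral_dominated_convergence[where w="Y 0"])
    show "AE x in M. (\<lambda>n. t n (Y 0 x)) \<longlonglongrightarrow> Y 0 x"
    proof (rule AE_I2)
      fix x
      obtain n0 where "Y 0 x < a ^ n0" using real_arch_pow[OF a] by blast
      then have "Y 0 x \<le> a ^ n" if "n0 \<le> n" for n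
        using power_increasing[OF that, of a] a by linarith
      then show "(\<lambda>n. t n (Y 0 x)) \<longlonglongrightarrow> Y 0 x"
        by (intro tendsto_eventually) (auto simp: t_def eventually_sequentially)
    qed
    show "AE x in M. norm (t n (Y 0 x)) \<le> Y 0 x" for n
      using nn by (auto simp: t_def)
  qed (use int in auto)
  from conv_T conv_J show ?thesis
  proof eventually_elim
    case (elim x)
    have "(\<lambda>n. (T n x - expectation (T n)) / k n + expectation (\<lambda>x. t n (Y 0 x))) \<longlonglongrightarrow> 0 + expectation (Y 0)"
      by (intro tendsto_add elim lim_t)
    moreover have "(T n x - expectation (T n)) / k n + expectation (\<lambda>x. t n (Y 0 x)) = T n x / k n" for n
      using k_pos[of n] by (simp add: ET field_simps)
    ultimately have "(\<lambda>n. T n x / k n) \<longlonglongrightarrow> expectation (Y 0)" by simp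
    then show ?case unfolding k_def[symmetric]
      by (rule Lim_transform_eventually) (use elim(2) in \<open>auto elim: eventually_mono\<close>)
  qed
qed

text \<open>Interpolating between the subsequences needs nondecreasing partial sums, hence
  nonnegative terms. Positive and negative parts are handled together as \<open>g (Y i x)\<close>
  with a Borel function \<open>g\<close> dominated by the absolute value, which preserves
  independence, the common law and integrability.\<close>

theorem strong_law_of_large_numbers:
  fixes Y :: "nat \<Rightarrow> 'a \<Rightarrow> real"
  assumes ind: "indep_vars (\<lambda>_. borel) Y UNIV"
    and int: "integrable M (Y 0)" and id: "\<And>n. distr M borel (Y n) = distr M borel (Y 0)"
  shows "AE x in M. (\<lambda>n. (\<Sum>i<n. Y i x) / n) \<longlonglongrightarrow> expectation (Y 0)"
proof -
  have [measurable]: "Y n \<in> borel_measurable M" for n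
    using ind by (auto simp: indep_vars_def)
  have nonneg_case: "AE x in M. (\<lambda>n. (\<Sum>i<n. g (Y i x)) / n) \<longlonglongrightarrow> expectation (\<lambda>x. g (Y 0 x))"
    if [measurable]: "g \<in> borel_measurable borel" and g: "\<And>y. 0 \<le> g y" "\<And>y. g y \<le> \<bar>y\<bar>"
    for g :: "real \<Rightarrow> real"
  proof -
    have "AE x in M. \<forall>p. (\<lambda>n. (\<Sum>i<nat \<lceil>(1 + 1 / real (Suc p)) ^ n\<rceil>. g (Y i x)) /
        nat \<lceil>(1 + 1 / real (Suc p)) ^ n\<rceil>) \<longlonglongrightarrow> expectation (\<lambda>x. g (Y 0 x))"
      unfolding AE_all_countable
    proof (intro allI strong_law_subsequence)
      show "indep_vars (\<lambda>_. borel) (\<lambda>n x. g (Y n x)) UNIV"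
        by (rule indep_vars_compose2[OF ind, where Y="\<lambda>_. g"]) simp
      show "integrable M (\<lambda>x. g (Y 0 x))"
        by (rule Bochner_Integration.integrable_bound[OF int]) (use g in auto)
      show "distr M borel (\<lambda>x. g (Y n x)) = distr M borel (\<lambda>x. g (Y 0 x))" for n
        using arg_cong[OF id[of n], of "\<lambda>N. distr N borel g"]
        by (subst (asm) (1 2) distr_distr) (auto simp: comp_def)
    qed (use g in auto)
    then show ?thesis
    proof eventually_elim
      case (elim x)
      show ?case
      proof (rule averages_converge_from_geometric_subsequences)
        show "mono (\<lambda>n. \<Sum>i<n. g (Y i x))"
          by (intro monoI sum_mono2) (use g in auto)
      qed (use elim g in \<open>auto intro: sum_nonneg\<close>)
    qed
  qed
  have "AE x in M. (\<lambda>n. (\<Sum>i<n. max 0 (Y i x)) / n) \<longlonglongrightarrow> expectation (\<lambda>x. max 0 (Y 0 x))"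
    and "AE x in M. (\<lambda>n. (\<Sum>i<n. max 0 (- Y i x)) / n) \<longlonglongrightarrow> expectation (\<lambda>x. max 0 (- Y 0 x))"
    by (rule nonneg_case; simp)+
  then show ?thesis
  proof eventually_elim
    case (elim x)
    have split: "y = max 0 y - max 0 (- y)" for y :: real by simp
    have "integrable M (\<lambda>x. max 0 (Y 0 x))" "integrable M (\<lambda>x. max 0 (- Y 0 x))"
      using int by auto
    then have "expectation (Y 0) = expectation (\<lambda>x. max 0 (Y 0 x)) - expectation (\<lambda>x. max 0 (- Y 0 x))"
      by (subst Bochner_Integration.integral_diff[symmetric]) (auto simp: split[symmetric])
    moreover have "(\<Sum>i<n. Y i x) / n = (\<Sum>i<n. max 0 (Y i x)) / n - (\<Sum>i<n. max 0 (- Y i x)) / n" for n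
      by (simp only: split[symmetric] sum_subtractf[symmetric] diff_divide_distrib[symmetric])
    ultimately show ?case
      using tendsto_diff[OF elim] by simp
  qed
qed

end

section \<open>Transfer to samples that are counted from 1 and whose law is given on another
  space\<close>

lemma (in prob_space) indep_vars_reindex:
  assumes f: "inj_on f J" and ind: "indep_vars M' X (f ` J)"
  shows "indep_vars (\<lambda>j. M' (f j)) (\<lambda>j. X (f j)) J"
  unfolding indep_vars_def2 indep_sets_def
proof (intro conjI ballI allI impI)
  fix j assume "j \<in> J"
  then show "X (f j) \<in> measurable M (M' (f j))"
    using ind by (auto simp: indep_vars_def2)
  then show "{X (f j) -` A \<inter> space M |A. A \<in> sets (M' (f j))} \<subseteq> events"
    by auto
next
  fix K A assume K: "K \<subseteq> J" "K \<noteq> {}" "finite K"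
    and A: "A \<in> (\<Pi> j\<in>K. {X (f j) -` A \<inter> space M |A. A \<in> sets (M' (f j))})"
  have fK: "inj_on f K" using f K(1) by (rule inj_on_subset)
  define B where "B i = A (the_inv_into K f i)" for i
  have B: "B (f j) = A j" if "j \<in> K" for j
    using that fK by (simp add: B_def the_inv_into_f_f)
  have "prob (\<Inter>i\<in>f ` K. B i) = (\<Prod>i\<in>f ` K. prob (B i))"
  proof (rule indep_setsD)
    show "indep_sets (\<lambda>i. {X i -` A \<inter> space M |A. A \<in> sets (M' i)}) (f ` J)"
      using ind by (simp add: indep_vars_def2)
    show "\<forall>i\<in>f ` K. B i \<in> {X i -` A \<inter> space M |A. A \<in> sets (M' i)}"
      using A B by auto
  qed (use K in auto)
  then show "prob (\<Inter>j\<in>K. A j) = (\<Prod>j\<in>K. prob (A j))"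
    using B fK by (simp add: prod.reindex)
qed

text \<open>\<open>X\<close> lives on its own space \<open>N\<close> and is tied to the sample only
  by its law, so integrability and the limit are carried over through the image measure.
  Independence passes to the shifted sequence because \<open>Suc\<close> is injective.\<close>

lemma (in prob_space) strong_law_of_large_numbers_functional:
  fixes Xs :: "nat \<Rightarrow> 'a \<Rightarrow> 'c::topological_space" and X :: "'v \<Rightarrow> 'c" and h :: "'c \<Rightarrow> real"
  assumes ind: "indep_vars (\<lambda>_. borel) Xs {1..}"
    and id: "\<And>j. 1 \<le> j \<Longrightarrow> distr M borel (Xs j) = distr N borel X"
    and X: "X \<in> borel_measurable N" and h: "h \<in> borel_measurable borel"
    and int: "integrable N (\<lambda>\<omega>. h (X \<omega>))"
  shows "AE \<omega> in M. (\<lambda>n. (\<Sum>j=1..n. h (Xs j \<omega>)) / n) \<longlonglongrightarrow> (LINT \<omega>|N. h (X \<omega>))"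
proof -
  define Y where "Y k \<omega> = h (Xs (Suc k) \<omega>)" for k \<omega>
  have Xs: "Xs (Suc k) \<in> borel_measurable M" for k
    using ind by (auto simp: indep_vars_def)
  have "range Suc = {1..}"
    using greaterThan_0 by auto
  then have "indep_vars (\<lambda>_. borel) (\<lambda>k. Xs (Suc k)) UNIV"
    using indep_vars_reindex[of Suc UNIV "\<lambda>_. borel" Xs] ind by simp
  then have indY: "indep_vars (\<lambda>_. borel) Y UNIV"
    unfolding Y_def by (rule indep_vars_compose2[where Y="\<lambda>_. h"]) (rule h)
  have distrY: "distr M borel (Y k) = distr N borel (\<lambda>\<omega>. h (X \<omega>))" for k
    using arg_cong[OF id[of "Suc k"], of "\<lambda>D. distr D borel h"] Xs X h
    by (simp add: distr_distr Y_def[abs_def] comp_def)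
  have intY: "integrable M (Y 0)" "expectation (Y 0) = (LINT \<omega>|N. h (X \<omega>))"
    using integrable_distr_eq[OF Xs[of 0] h] integrable_distr_eq[OF X h] int
      integral_distr[OF Xs[of 0] h] integral_distr[OF X h] id[of "Suc 0"]
    by (simp_all add: Y_def[abs_def])
  have "AE \<omega> in M. (\<lambda>n. (\<Sum>k<n. Y k \<omega>) / n) \<longlonglongrightarrow> expectation (Y 0)"
    by (rule strong_law_of_large_numbers[OF indY intY(1)]) (simp only: distrY)
  then show ?thesis
    by (simp add: intY(2) Y_def sum.atLeast1_atMost_eq)
qed

section \<open>Separability and completeness of the Hilbert space\<close>

lemma l2_rel_refl_iff [simp]: "l2_rel f f \<longleftrightarrow> sq_integrable f"
  by (auto simp: l2_rel_def)

lemma sq_integrable_l2_fun [simp]: "sq_integrable (l2_fun x)"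
  using Quotient3_rep_reflp[OF Quotient3_l2, of x] by simp

lemma l2_class_l2_fun [simp]: "l2_class (l2_fun x) = x"
  by (rule Quotient3_abs_rep[OF Quotient3_l2])

lemma l2_class_eqI:
  assumes "sq_integrable f" "sq_integrable g" "AE t in unit_leb. f t = g t"
  shows "l2_class f = l2_class g"
  using assms by (intro Quotient3_rel_abs[OF Quotient3_l2]) (simp add: l2_rel_def)

lemma sq_integrable_measurable [measurable_dest]:
  "sq_integrable f \<Longrightarrow> f \<in> borel_measurable unit_leb"
  by (simp add: sq_integrable_def)

lemma borel_measurable_l2_fun [measurable]: "l2_fun x \<in> borel_measurable unit_leb"
  by (rule sq_integrable_measurable) simp

lemma sq_integrable_dominated:
  assumes "f \<in> borel_measurable unit_leb" "sq_integrable g"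
    and "\<And>t. \<bar>f t\<bar> \<le> \<bar>g t\<bar>"
  shows "sq_integrable f"
  unfolding sq_integrable_def
proof
  show "integrable unit_leb (\<lambda>t. (f t)\<^sup>2)"
    by (rule Bochner_Integration.integrable_bound[where f="\<lambda>t. (g t)\<^sup>2"])
      (use assms in \<open>auto simp: sq_integrable_def abs_le_square_iff[symmetric]\<close>)
qed (use assms in simp)

lemma finite_measure_unit_leb: "finite_measure unit_leb"
  by (intro finite_measure_lebesgue_on) auto

lemma sq_integrable_const [simp]: "sq_integrable (\<lambda>_. c)"
  using finite_measure_unit_leb
  by (auto simp: sq_integrable_def intro!: finite_measure.integrable_const)

lemma norm_l2_class_power2:
  "sq_integrable f \<Longrightarrow> (norm (l2_class f))\<^sup>2 = (LINT t|unit_leb. (f t)\<^sup>2)"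
  by (subst power2_norm_eq_inner) (simp add: inner_l2.abs_eq power2_eq_square)

text \<open>Both \<open>F n\<close> and \<open>f\<close> are bounded by \<open>g\<close> in absolute
  value, so the squared differences are dominated by \<open>(2 * g t)\<^sup>2\<close> and their
  integrals tend to 0.\<close>

lemma l2_class_tendsto_dominated:
  assumes meas: "\<And>n. F n \<in> borel_measurable unit_leb" and g: "sq_integrable g"
    and bound: "\<And>n t. \<bar>F n t\<bar> \<le> \<bar>g t\<bar>" and lim: "\<And>t. (\<lambda>n. F n t) \<longlonglongrightarrow> f t"
  shows "(\<lambda>n. l2_class (F n)) \<longlonglongrightarrow> l2_class f"
proof -
  note [measurable] = meas
  have [measurable]: "f \<in> borel_measurable unit_leb"
    by (rule borel_measurable_LIMSEQ_real[OF lim meas])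
  have fb: "\<bar>f t\<bar> \<le> \<bar>g t\<bar>" for t
    by (rule LIMSEQ_le_const2[OF tendsto_rabs[OF lim]]) (use bound in auto)
  have F: "sq_integrable (F n)" for n
    by (rule sq_integrable_dominated[OF meas g bound])
  have f: "sq_integrable f"
    by (rule sq_integrable_dominated[OF _ g fb]) measurable
  have "(\<lambda>n. LINT t|unit_leb. (F n t - f t)\<^sup>2) \<longlonglongrightarrow> (LINT t|unit_leb. 0)"
  proof (rule integral_dominated_convergence[where w="\<lambda>t. 4 * (g t)\<^sup>2"])
    show "integrable unit_leb (\<lambda>t. 4 * (g t)\<^sup>2)"
      using g by (simp add: sq_integrable_def)
    show "AE t in unit_leb. (\<lambda>n. (F n t - f t)\<^sup>2) \<longlonglongrightarrow> 0"
    proof (rule AE_I2)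
      fix t
      have "(\<lambda>n. (F n t - f t)\<^sup>2) \<longlonglongrightarrow> (f t - f t)\<^sup>2"
        by (intro tendsto_intros lim)
      then show "(\<lambda>n. (F n t - f t)\<^sup>2) \<longlonglongrightarrow> 0" by simp
    qed
    show "AE t in unit_leb. norm ((F n t - f t)\<^sup>2) \<le> 4 * (g t)\<^sup>2" for n
    proof (rule AE_I2)
      fix t
      have "\<bar>F n t - f t\<bar> \<le> \<bar>2 * g t\<bar>"
        using bound[of n t] fb[of t] by simp
      then have "(F n t - f t)\<^sup>2 \<le> (2 * g t)\<^sup>2"
        by (simp only: abs_le_square_iff)
      then show "norm ((F n t - f t)\<^sup>2) \<le> 4 * (g t)\<^sup>2"
        by (simp add: power_mult_distrib)
    qed
  qed auto
  moreover have "(norm (l2_class (F n) - l2_class f))\<^sup>2 = (LINT t|unit_leb. (F n t - f t)\<^sup>2)" for n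
    by (simp add: minus_l2.abs_eq F f norm_l2_class_power2 sq_integrable_diff)
  ultimately have "(\<lambda>n. (norm (l2_class (F n) - l2_class f))\<^sup>2) \<longlonglongrightarrow> 0"
    by simp
  from tendsto_real_sqrt[OF this] have "(\<lambda>n. norm (l2_class (F n) - l2_class f)) \<longlonglongrightarrow> 0"
    by simp
  then show ?thesis
    by (rule LIM_zero_cancel[OF tendsto_norm_zero_cancel])
qed

lemma sq_integrable_indicator:
  "A \<in> sets borel \<Longrightarrow> sq_integrable (indicator A)"
  by (rule sq_integrable_dominated[OF _ sq_integrable_const[of 1]])
    (auto intro!: measurable_restrict_space1 measurable_completion simp: indicator_def)

lemma l2_class_sum:
  assumes "finite I" "\<And>i. i \<in> I \<Longrightarrow> sq_integrable (F i)"
  shows "sq_integrable (\<lambda>t. \<Sum>i\<in>I. F i t) \<and>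
    l2_class (\<lambda>t. \<Sum>i\<in>I. F i t) = (\<Sum>i\<in>I. l2_class (F i))"
  using assms
proof (induction rule: finite_induct)
  case empty
  then show ?case by (simp add: zero_l2_def)
next
  case (insert i I)
  then have "l2_class (\<lambda>t. F i t + (\<Sum>i\<in>I. F i t)) = l2_class (F i) + l2_class (\<lambda>t. \<Sum>i\<in>I. F i t)"
    by (subst plus_l2.abs_eq) auto
  with insert show ?case
    by (simp add: sq_integrable_add)
qed

text \<open>With strict approximation from above, the indicators of \<open>{..q n}\<close> converge
  at every point to that of \<open>{..a}\<close>, the point \<open>a\<close> included.\<close>

lemma rat_sequence_from_above:
  fixes a :: real
  obtains q :: "nat \<Rightarrow> rat"
  where "\<And>n. a < of_rat (q n)" "(\<lambda>n. real_of_rat (q n)) \<longlonglongrightarrow> a"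
proof -
  have "\<exists>q::rat. a < of_rat q \<and> of_rat q < a + 1 / Suc n" for n
    using of_rat_dense[of a "a + 1 / Suc n"] by auto
  then obtain q :: "nat \<Rightarrow> rat" where q: "\<And>n. a < of_rat (q n)" "\<And>n. of_rat (q n) < a + 1 / Suc n"
    by metis
  have "(\<lambda>n. a + 1 / Suc n) \<longlonglongrightarrow> a + 0"
    by (intro tendsto_intros lim_1_over_n[THEN LIMSEQ_Suc])
  then have lim: "(\<lambda>n. a + 1 / Suc n) \<longlonglongrightarrow> a" by simp
  have "(\<lambda>n. real_of_rat (q n)) \<longlonglongrightarrow> a"
    by (rule tendsto_sandwich[OF always_eventually always_eventually tendsto_const lim])
      (use q in \<open>simp_all add: less_imp_le del: of_nat_Suc\<close>)
  with q(1) show thesis by (rule that)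
qed

text \<open>Closedness gives closure under dominated pointwise limits. This carries membership from
  rational to real half-lines, then to Borel sets, by linearity to simple functions, and by
  approximation to every class.\<close>

lemma closed_subspace_eq_UNIV_if_step_functions:
  fixes V :: "l2 set"
  assumes V: "subspace V" "closed V"
    and step: "\<And>q::rat. l2_class (indicator {..real_of_rat q}) \<in> V"
  shows "V = UNIV"
proof -
  have lim: "l2_class f \<in> V"
    if "\<And>n. F n \<in> borel_measurable unit_leb" "sq_integrable g" "\<And>n t. \<bar>F n t\<bar> \<le> \<bar>g t\<bar>"
      "\<And>t. (\<lambda>n. F n t) \<longlonglongrightarrow> f t" "\<And>n. l2_class (F n) \<in> V" for F f g
    using closed_sequentially[OF V(2) that(5) l2_class_tendsto_dominated[OF that(1-4)]] .
  have ind_lim: "l2_class (indicator A) \<in> V"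
    if "\<And>n. B n \<in> sets borel" "\<And>t. (\<lambda>n. indicator (B n) t :: real) \<longlonglongrightarrow> indicator A t"
      "\<And>n. l2_class (indicator (B n)) \<in> V" for A and B :: "nat \<Rightarrow> real set"
    by (rule lim[OF sq_integrable_measurable[OF sq_integrable_indicator[OF that(1)]]
          sq_integrable_const[of 1] _ that(2,3)])
      (auto simp: indicator_def)
  have atMost: "l2_class (indicator {..a}) \<in> V" for a :: real
  proof -
    obtain q :: "nat \<Rightarrow> rat" where q: "\<And>n. a < of_rat (q n)" "(\<lambda>n. real_of_rat (q n)) \<longlonglongrightarrow> a"
      using rat_sequence_from_above[of a] by metis
    show ?thesis
    proof (rule ind_lim[where B="\<lambda>n. {..real_of_rat (q n)}"])
      fix t
      show "(\<lambda>n. indicator {..real_of_rat (q n)} t :: real) \<longlonglongrightarrow> indicator {..a} t"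
      proof (cases "t \<le> a")
        case True
        then have "t \<le> real_of_rat (q n)" for n using q(1)[of n] by linarith
        with True show ?thesis by simp
      next
        case False
        have "\<forall>\<^sub>F n in sequentially. real_of_rat (q n) < t"
          using False by (intro order_tendstoD(2)[OF q(2)]) auto
        then have "\<forall>\<^sub>F n in sequentially. indicator {..real_of_rat (q n)} t = (0::real)"
          by eventually_elim auto
        with False show ?thesis by (simp add: tendsto_eventually)
      qed
    qed (use step in auto)
  qed
  have sets_eq: "sets borel = sigma_sets UNIV (range (\<lambda>a::real. {..a}))"
    by (subst borel_eq_atMost) simp
  have ind: "l2_class (indicator A) \<in> V" if "A \<in> sets borel" for A :: "real set"
  proof -
    have UNIV: "l2_class (indicator UNIV) \<in> V"
    proof (rule ind_lim[where B="\<lambda>n. {..real n}"])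
      fix t
      obtain m :: nat where "t \<le> real m" using real_arch_simple by blast
      then have "indicator {..real n} t = (1::real)" if "m \<le> n" for n using that by simp
      then show "(\<lambda>n. indicator {..real n} t :: real) \<longlonglongrightarrow> indicator UNIV t"
        by (intro tendsto_eventually) (auto simp: eventually_sequentially)
    qed (use atMost in auto)
    \<comment> \<open>Dynkin's theorem: half-lines are stable under intersection, so complements and
      countable disjoint unions remain. Disjointness makes the indicator of a finite union the sum
      of the indicators.\<close>
    have "Int_stable (range (\<lambda>a::real. {..a}))"
      by (auto simp: Int_stable_def)
    moreover have "range (\<lambda>a::real. {..a}) \<subseteq> Pow UNIV" by simp
    moreover have "A \<in> sigma_sets UNIV (range (\<lambda>a::real. {..a}))"
      using that sets_eq by simp
    ultimately show ?thesis
    proof (induction rule: sigma_sets_induct_disjoint)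
      case (basic A)
      then show ?case using atMost by auto
    next
      case empty
      then show ?case
        using subspace_0[OF V(1)] by (simp add: zero_l2_def indicator_def)
    next
      case (compl A)
      have "A \<in> sets borel" using compl sets_eq by simp
      then have "l2_class (\<lambda>t. 1 - indicator A t) = l2_class (\<lambda>_. 1) - l2_class (indicator A)"
        by (subst minus_l2.abs_eq) (auto simp: sq_integrable_indicator)
      moreover have "indicator (UNIV - A) = (\<lambda>t. 1 - indicator A t :: real)"
        by (auto simp: indicator_def)
      ultimately show ?case
        using subspace_diff[OF V(1) UNIV compl(2)] by simp
    next
      case (union A)
      have A: "A i \<in> sets borel" for i using union sets_eq by auto
      have "l2_class (indicator (\<Union>i<n. A i)) \<in> V" for n
      proof (induction n)
        case 0
        then show ?case
          using subspace_0[OF V(1)] by (simp add: zero_l2_def indicator_def)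
      next
        case (Suc n)
        have "A i \<inter> A n = {}" if "i < n" for i
          using union(1) that by (intro disjoint_family_onD) auto
        then have disj: "(\<Union>i<n. A i) \<inter> A n = {}" by blast
        have "(\<Union>i<Suc n. A i) = (\<Union>i<n. A i) \<union> A n"
          by (auto simp: lessThan_Suc)
        with disj have eq: "indicator (\<Union>i<Suc n. A i) = (\<lambda>t. indicator (\<Union>i<n. A i) t + (indicator (A n) t :: real))"
          by (simp add: indicator_add fun_eq_iff)
        have "l2_class (indicator (\<Union>i<Suc n. A i)) = l2_class (indicator (\<Union>i<n. A i)) + l2_class (indicator (A n))"
          unfolding eq using A by (subst plus_l2.abs_eq) (auto intro!: sq_integrable_indicator)
        then show ?case
          using subspace_add[OF V(1) Suc union(3)] by simp
      qed
      then show ?case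
        by (rule ind_lim[where B="\<lambda>n. \<Union>i<n. A i", rotated -1]) (use A in \<open>auto intro: LIMSEQ_indicator_UN\<close>)
    qed
  qed
  have simple: "l2_class s \<in> V" if s: "simple_function borel s" for s :: "real \<Rightarrow> real"
  proof -
    have B: "s -` {y} \<in> sets borel" for y
      using simple_functionD(2)[OF s, of "{y}"] by simp
    have fin: "finite (range s)"
      using simple_functionD(1)[OF s] by simp
    have eq: "s = (\<lambda>t. \<Sum>y\<in>range s. y * indicator (s -` {y}) t)"
    proof
      fix t
      have "(\<Sum>y\<in>range s. y * indicator (s -` {y}) t) = (\<Sum>y\<in>range s. if y = s t then y else 0)"
        by (intro sum.cong) (auto simp: indicator_def)
      also have "\<dots> = s t" using fin by simp
      finally show "s t = (\<Sum>y\<in>range s. y * indicator (s -` {y}) t)" ..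
    qed
    have "l2_class s = (\<Sum>y\<in>range s. l2_class (\<lambda>t. y * indicator (s -` {y}) t))"
      by (subst eq) (use l2_class_sum[OF fin, of "\<lambda>y t. y * indicator (s -` {y}) t"] B in
          \<open>auto simp: sq_integrable_scale sq_integrable_indicator\<close>)
    also have "\<dots> = (\<Sum>y\<in>range s. y *\<^sub>R l2_class (indicator (s -` {y})))"
      by (intro sum.cong refl) (simp add: scaleR_l2.abs_eq sq_integrable_indicator B)
    also have "\<dots> \<in> V"
      by (intro subspace_sum subspace_scale V ind B)
    finally show ?thesis .
  qed
  have "x \<in> V" for x
  proof -
    \<comment> \<open>A representative is only Lebesgue measurable, whereas the approximation works
      with Borel simple functions. Extended by 0 to the whole line, it agrees almost everywhere with
      a Borel function.\<close>
    define f where "f t = (if t \<in> {0..1} then l2_fun x t else 0)" for t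
    have "f \<in> borel_measurable lebesgue"
      unfolding f_def by (subst borel_measurable_if) auto
    then obtain g where g[measurable]: "g \<in> borel_measurable lborel" and fg: "AE t in lborel. f t = g t"
      using completion_ex_borel_measurable_real by blast
    have AE: "AE t in unit_leb. l2_fun x t = g t"
      using AE_completion[OF fg] by (subst AE_restrict_space_iff) (auto simp: f_def)
    have gm[measurable]: "g \<in> borel_measurable unit_leb"
      using g by (auto intro!: measurable_restrict_space1 measurable_completion)
    have "integrable unit_leb (\<lambda>t. (g t)\<^sup>2)"
      by (rule integrable_cong_AE_imp[where g="\<lambda>t. (l2_fun x t)\<^sup>2"])
        (use AE sq_integrable_l2_fun[of x] in \<open>auto simp: sq_integrable_def elim: eventually_mono\<close>)
    then have sg: "sq_integrable g" by (simp add: sq_integrable_def)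
    have xg: "x = l2_class g"
      using l2_class_eqI[OF sq_integrable_l2_fun sg AE] by simp
    obtain s where s: "\<And>i. simple_function borel (s i)" "\<And>t. (\<lambda>i. s i t) \<longlonglongrightarrow> g t"
      "\<And>i t. \<bar>s i t\<bar> \<le> 2 * \<bar>g t\<bar>"
      using borel_measurable_implies_sequence_metric[of g borel 0] g by auto
    have "l2_class g \<in> V"
    proof (rule lim[where F=s and g="\<lambda>t. 2 * g t"])
      show "s n \<in> borel_measurable unit_leb" for n
        using borel_measurable_simple_function[OF s(1)]
        by (auto intro!: measurable_restrict_space1 measurable_completion)
      show "sq_integrable (\<lambda>t. 2 * g t)"
        by (rule sq_integrable_scale[OF sg])
    qed (use s simple in \<open>auto simp: abs_mult\<close>)
    then show ?thesis using xg by simp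
  qed
  then show ?thesis by auto
qed

text \<open>Rational combinations of indicators of rational half-lines are dense, because their
  closure is a closed subspace containing all these indicators. Balls of radius
  \<open>1 / Suc n\<close> around them give a countable base.\<close>

instance l2 :: second_countable_topology
proof
  define e where "e q = l2_class (indicator {..real_of_rat q})" for q
  \<comment> \<open>Lists of pairs of rationals form a countable type, so the range is countable at
    once; appending lists adds, and mapping over a list scales by a rational.\<close>
  define comb where "comb xs = (\<Sum>(r, q)\<leftarrow>xs. real_of_rat r *\<^sub>R e q)" for xs
  define D where "D = range comb"
  have comb_append: "comb xs + comb ys = comb (xs @ ys)" for xs ys
    by (simp add: comb_def)
  have comb_scale: "real_of_rat r *\<^sub>R comb xs = comb (map (\<lambda>(r', q). (r * r', q)) xs)" for r xs
    by (induction xs) (auto simp: comb_def scaleR_add_right of_rat_mult)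
  have "subspace (closure D)"
    unfolding subspace_def
  proof (intro conjI ballI allI)
    have "comb [] \<in> D" by (simp add: D_def)
    then show "0 \<in> closure D" using closure_subset by (auto simp: comb_def)
  next
    fix x y assume "x \<in> closure D" "y \<in> closure D"
    then obtain u v where u: "\<And>n. u n \<in> D" "u \<longlonglongrightarrow> x" and v: "\<And>n. v n \<in> D" "v \<longlonglongrightarrow> y"
      by (auto simp: closure_sequential)
    have "u n + v n \<in> D" for n
      using u(1)[of n] v(1)[of n] by (auto simp: D_def comb_append)
    then show "x + y \<in> closure D"
      using tendsto_add[OF u(2) v(2)] unfolding closure_sequential
      by (intro exI[of _ "\<lambda>n. u n + v n"]) simp
  next
    \<comment> \<open>\<open>D\<close> is stable under rational scalars only, so both the scalar and
      the vector are approximated.\<close>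
    fix c x assume "x \<in> closure D"
    then obtain u where u: "\<And>n. u n \<in> D" "u \<longlonglongrightarrow> x"
      by (auto simp: closure_sequential)
    obtain r :: "nat \<Rightarrow> rat" where r: "(\<lambda>n. real_of_rat (r n)) \<longlonglongrightarrow> c"
      using rat_sequence_from_above by metis
    from tendsto_scaleR[OF r u(2)]
    have "(\<lambda>n. real_of_rat (r n) *\<^sub>R u n) \<longlonglongrightarrow> c *\<^sub>R x" .
    moreover have "real_of_rat (r n) *\<^sub>R u n \<in> D" for n
      using u(1)[of n] by (auto simp: D_def comb_scale)
    ultimately show "c *\<^sub>R x \<in> closure D"
      unfolding closure_sequential
      by (intro exI[of _ "\<lambda>n. real_of_rat (r n) *\<^sub>R u n"]) simp
  qed
  moreover have "e q \<in> closure D" for q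
  proof -
    have "comb [(1, q)] \<in> D" by (simp add: D_def)
    then show ?thesis using closure_subset by (auto simp: comb_def)
  qed
  ultimately have dense: "closure D = UNIV"
    by (intro closed_subspace_eq_UNIV_if_step_functions) (auto simp: e_def)
  have "countable D" unfolding D_def by simp
  define B where "B = (\<lambda>(d, n::nat). ball d (1 / Suc n)) ` (D \<times> UNIV)"
  have "topological_basis B"
  proof (rule topological_basisI)
    show "open U" if "U \<in> B" for U using that by (auto simp: B_def)
    fix U :: "l2 set" and x assume "open U" "x \<in> U"
    then obtain \<epsilon> where \<epsilon>: "0 < \<epsilon>" "ball x \<epsilon> \<subseteq> U" by (meson openE)
    obtain n :: nat where n: "1 / Suc n < \<epsilon> / 2"
      using nat_approx_posE[of "\<epsilon> / 2"] \<epsilon>(1) by auto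
    obtain d where d: "d \<in> D" "dist d x < 1 / Suc n"
      using dense closure_approachable[of x D] by (metis UNIV_I of_nat_0_less_iff zero_less_Suc zero_less_divide_1_iff)
    have "ball d (1 / Suc n) \<subseteq> U"
    proof
      fix y assume "y \<in> ball d (1 / Suc n)"
      then have "dist x y < \<epsilon>"
        using n d(2) dist_triangle2[of x y d] by (auto simp: dist_commute)
      then show "y \<in> U" using \<epsilon> by auto
    qed
    moreover have "x \<in> ball d (1 / Suc n)" "ball d (1 / Suc n) \<in> B"
      using d by (auto simp: B_def)
    ultimately show "\<exists>B'\<in>B. x \<in> B' \<and> B' \<subseteq> U" by blast
  qed
  moreover have "countable B"
    unfolding B_def using \<open>countable D\<close> by (intro countable_image countable_SIGMA) auto
  ultimately show "\<exists>B::l2 set set. countable B \<and> open = generate_topology B"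
    using topological_basis_imp_subbasis by blast
qed

text \<open>Riesz-Fischer: a subsequence with geometrically small increments converges almost
  everywhere, because on a finite measure space the absolute increments have summable integrals.
  Fatou's lemma shows that the pointwise limit is also the limit in norm, and a Cauchy sequence
  follows its convergent subsequence.\<close>

instance l2 :: banach
proof
  fix X :: "nat \<Rightarrow> l2" assume X: "Cauchy X"
  have "\<exists>N. \<forall>m\<ge>N. \<forall>n\<ge>N. norm (X m - X n) < (1 / 2) ^ k" for k
    using CauchyD[OF X, of "(1 / 2) ^ k"] by simp
  then obtain N where N: "\<And>k m n. N k \<le> m \<Longrightarrow> N k \<le> n \<Longrightarrow> norm (X m - X n) < (1 / 2) ^ k"
    by metis
  \<comment> \<open>The sum puts \<open>r j\<close> above every \<open>N k\<close> with
    \<open>k \<le> j\<close>; the summand \<open>k\<close> makes \<open>r\<close> strictly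
    increasing.\<close>
  define r where "r k = k + (\<Sum>i\<le>k. N i)" for k
  have r: "strict_mono r"
    unfolding strict_mono_Suc_iff by (simp add: r_def)
  have "N k \<le> (\<Sum>i\<le>k. N i)" for k
    by (rule member_le_sum) auto
  then have r_ge: "N k \<le> r j" if "k \<le> j" for j k
    using monoD[OF strict_mono_mono[OF r] that] by (metis le_trans r_def trans_le_add2)
  define f where "f k = l2_fun (X (r k))" for k
  have sq_f: "sq_integrable (f k)" for k by (simp add: f_def)
  have [measurable]: "f k \<in> borel_measurable unit_leb" for k by (simp add: f_def)
  have sq_d: "sq_integrable (\<lambda>t. f j t - f k t)" for j k
    by (intro sq_integrable_diff sq_f)
  have d_eq: "l2_class (\<lambda>t. f j t - f k t) = X (r j) - X (r k)" for j k
    using minus_l2.abs_eq[of "f j" "f k"] sq_f by (simp add: f_def)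
  have d_bound: "(LINT t|unit_leb. (f j t - f i t)\<^sup>2) \<le> ((1 / 2) ^ k)\<^sup>2" if "k \<le> i" "k \<le> j" for i j k
  proof -
    have "(LINT t|unit_leb. (f j t - f i t)\<^sup>2) = (norm (X (r j) - X (r i)))\<^sup>2"
      using norm_l2_class_power2[OF sq_d] by (simp add: d_eq)
    also have "\<dots> \<le> ((1 / 2) ^ k)\<^sup>2"
      using N[OF r_ge r_ge, OF that(2,1)] by (intro power_mono) auto
    finally show ?thesis .
  qed
  have [simp]: "integrable unit_leb (\<lambda>t. c)" for c :: real
    by (intro finite_measure.integrable_const finite_measure_unit_leb)
  have "AE t in unit_leb. summable (\<lambda>k. \<bar>f (Suc k) t - f k t\<bar>)"
  proof (rule AE_summable_if_integrals_bounded)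
    have sqi: "integrable unit_leb (\<lambda>t. (f (Suc k) t - f k t)\<^sup>2)" for k
      using sq_d by (simp add: sq_integrable_def)
    show int: "integrable unit_leb (\<lambda>t. \<bar>f (Suc k) t - f k t\<bar>)" for k
      by (rule integrable_abs, rule finite_measure.square_integrable_imp_integrable[OF finite_measure_unit_leb _ sqi])
        measurable
    \<comment> \<open>AM-GM: \<open>y \<le> 2 ^ k / 2 * y\<^sup>2 + (1 / 2) ^ k / 2\<close>\<close>
    have "(LINT t|unit_leb. \<bar>f (Suc k) t - f k t\<bar>) \<le> (1 / 2) ^ k" for k
    proof -
      have "(LINT t|unit_leb. \<bar>f (Suc k) t - f k t\<bar>)
          \<le> (LINT t|unit_leb. 2 ^ k / 2 * (f (Suc k) t - f k t)\<^sup>2 + (1 / 2) ^ k / 2)"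
      proof (rule integral_mono[OF int])
        fix t
        define y where "y = \<bar>f (Suc k) t - f k t\<bar>"
        have "0 \<le> (2 ^ k * y - 1)\<^sup>2" by simp
        also have "\<dots> = 2 * 2 ^ k * (2 ^ k / 2 * y\<^sup>2 + (1 / 2) ^ k / 2 - y)"
          by (simp add: power2_eq_square field_simps power_divide)
        finally have "y \<le> 2 ^ k / 2 * y\<^sup>2 + (1 / 2) ^ k / 2"
          using zero_less_power[of "2::real" k] by (simp add: zero_le_mult_iff linorder_not_le[symmetric])
        then show "\<bar>f (Suc k) t - f k t\<bar> \<le> 2 ^ k / 2 * (f (Suc k) t - f k t)\<^sup>2 + (1 / 2) ^ k / 2"
          by (simp add: y_def)
      qed (use sqi in auto)
      also have "\<dots> = 2 ^ k / 2 * (LINT t|unit_leb. (f (Suc k) t - f k t)\<^sup>2) + (1 / 2) ^ k / 2"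
        using sqi by (simp add: measure_restrict_space)
      also have "\<dots> \<le> 2 ^ k / 2 * ((1 / 2) ^ k)\<^sup>2 + (1 / 2) ^ k / 2"
        by (intro add_right_mono mult_left_mono d_bound) auto
      also have "\<dots> = (1 / 2) ^ k"
        by (simp add: power2_eq_square power_divide)
      finally show ?thesis .
    qed
    then have "(\<Sum>k<n. LINT t|unit_leb. \<bar>f (Suc k) t - f k t\<bar>) \<le> (\<Sum>k<n. (1 / 2) ^ k)" for n
      by (intro sum_mono)
    moreover have "(\<Sum>k<n. (1 / 2) ^ k) \<le> (2::real)" for n
      using sum_le_suminf[OF summable_geometric, of "1 / 2 :: real" "{..<n}"]
      by (simp add: suminf_geometric)
    ultimately show "(\<Sum>k<n. LINT t|unit_leb. \<bar>f (Suc k) t - f k t\<bar>) \<le> 2" for n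
      by (meson order_trans)
  qed simp
  then have conv: "AE t in unit_leb. convergent (\<lambda>k. f k t)"
  proof eventually_elim
    case (elim t)
    then have "summable (\<lambda>k. f (Suc k) t - f k t)"
      by (rule summable_rabs_cancel)
    then have "convergent (\<lambda>n. (\<Sum>k<n. f (Suc k) t - f k t) + f 0 t)"
      by (intro convergent_add convergent_const) (simp add: summable_iff_convergent)
    then show ?case by (simp only: sum_lessThan_telescope[of "\<lambda>k. f k t"] diff_add_cancel)
  qed
  \<comment> \<open>Where the sequence diverges, \<open>lim\<close> is one fixed unspecified value,
    so \<open>g\<close> stays measurable.\<close>
  define g where "g t = lim (\<lambda>k. f k t)" for t
  have [measurable]: "g \<in> borel_measurable unit_leb"
    unfolding g_def by measurable
  have lim: "AE t in unit_leb. (\<lambda>k. f k t) \<longlonglongrightarrow> g t"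
    using conv by eventually_elim (simp add: g_def convergent_LIMSEQ_iff)
  \<comment> \<open>Letting \<open>j\<close> tend to infinity in \<open>d_bound\<close> yields both
    the square integrability of \<open>g - f k\<close> and the rate of convergence.\<close>
  have fatou: "(\<integral>\<^sup>+t. ennreal ((g t - f k t)\<^sup>2) \<partial>unit_leb) \<le> ennreal (((1 / 2) ^ k)\<^sup>2)" for k
  proof -
    have "(\<integral>\<^sup>+t. ennreal ((g t - f k t)\<^sup>2) \<partial>unit_leb)
        = (\<integral>\<^sup>+t. liminf (\<lambda>j. ennreal ((f j t - f k t)\<^sup>2)) \<partial>unit_leb)"
    proof (rule nn_integral_cong_AE)
      show "AE t in unit_leb. ennreal ((g t - f k t)\<^sup>2) = liminf (\<lambda>j. ennreal ((f j t - f k t)\<^sup>2))"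
        using lim
      proof eventually_elim
        case (elim t)
        have "(\<lambda>j. ennreal ((f j t - f k t)\<^sup>2)) \<longlonglongrightarrow> ennreal ((g t - f k t)\<^sup>2)"
          by (intro tendsto_intros elim)
        from lim_imp_Liminf[OF sequentially_bot this] show ?case by (rule sym)
      qed
    qed
    also have "\<dots> \<le> liminf (\<lambda>j. \<integral>\<^sup>+t. ennreal ((f j t - f k t)\<^sup>2) \<partial>unit_leb)"
      by (intro nn_integral_liminf) measurable
    also have "\<dots> \<le> ennreal (((1 / 2) ^ k)\<^sup>2)"
    proof (rule Liminf_le)
      have "(\<integral>\<^sup>+t. ennreal ((f j t - f k t)\<^sup>2) \<partial>unit_leb) \<le> ennreal (((1 / 2) ^ k)\<^sup>2)" if "k \<le> j" for j
        using sq_d d_bound[OF order_refl that]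
        by (subst nn_integral_eq_integral) (auto simp: sq_integrable_def intro: ennreal_leI)
      then show "\<forall>\<^sub>F j in sequentially. (\<integral>\<^sup>+t. ennreal ((f j t - f k t)\<^sup>2) \<partial>unit_leb) \<le> ennreal (((1 / 2) ^ k)\<^sup>2)"
        by (auto simp: eventually_sequentially)
    qed simp
    finally show ?thesis .
  qed
  have sq_gf: "sq_integrable (\<lambda>t. g t - f k t)" for k
    unfolding sq_integrable_def using fatou[of k]
    by (auto intro!: integrableI_nonneg simp: le_less_trans[OF _ ennreal_less_top])
  have sq_g: "sq_integrable g"
    using sq_integrable_add[OF sq_gf[of 0] sq_f[of 0]] by simp
  have bound: "norm (l2_class g - X (r k)) \<le> (1 / 2) ^ k" for k
  proof -
    have "l2_class g - X (r k) = l2_class (\<lambda>t. g t - f k t)"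
      using minus_l2.abs_eq[of g "f k"] sq_f sq_g by (simp add: f_def)
    then have "(norm (l2_class g - X (r k)))\<^sup>2 = (LINT t|unit_leb. (g t - f k t)\<^sup>2)"
      using norm_l2_class_power2[OF sq_gf] by simp
    also have "ennreal \<dots> \<le> ennreal (((1 / 2) ^ k)\<^sup>2)"
      using fatou[of k] sq_gf[of k] by (subst nn_integral_eq_integral[symmetric]) (auto simp: sq_integrable_def)
    finally have "(norm (l2_class g - X (r k)))\<^sup>2 \<le> ((1 / 2) ^ k)\<^sup>2"
      by simp
    then show ?thesis by (rule power2_le_imp_le) simp
  qed
  have "(X \<circ> r) \<longlonglongrightarrow> l2_class g"
  proof (rule LIM_zero_cancel, rule Lim_null_comparison)
    show "\<forall>\<^sub>F k in sequentially. norm ((X \<circ> r) k - l2_class g) \<le> (1 / 2) ^ k"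
      using bound by (simp add: norm_minus_commute)
  qed (simp add: LIMSEQ_power_zero)
  from Cauchy_converges_subseq[OF X r this]
  show "convergent X" by (rule convergentI)
qed

section \<open>Means, covariances and the test statistic\<close>

text \<open>Inner products commute with the Bochner integral, and an element is determined by its
  inner products.\<close>

lemma mean_element_eq_integral:
  assumes "integrable N Y"
  shows "mean_element N Y = integral\<^sup>L N Y"
  unfolding mean_element_def
proof (rule the_equality)
  show "\<forall>x. (LINT \<omega>|N. inner (Y \<omega>) x) = inner (integral\<^sup>L N Y) x"
    using assms by (simp add: integral_inner_left)
  then show "m = integral\<^sup>L N Y" if "\<forall>x. (LINT \<omega>|N. inner (Y \<omega>) x) = inner m x" for m
    using that by (metis vector_eq_rdot)
qed

text \<open>The quadratic form is the variance of \<open>inner (X \<omega>) f\<close>. The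
  definition centres only one of the two factors, which is harmless because the centred factor has
  mean zero.\<close>

lemma (in prob_space) inner_cov_operator:
  fixes X :: "'a \<Rightarrow> l2"
  assumes [measurable]: "X \<in> borel_measurable M"
    and sq: "integrable M (\<lambda>\<omega>. (norm (X \<omega>))\<^sup>2)"
  shows "integrable M X"
    and "integrable M (\<lambda>\<omega>. (inner (X \<omega>) f)\<^sup>2)"
    and "inner (cov_operator M X f) f
      = expectation (\<lambda>\<omega>. (inner (X \<omega>) f)\<^sup>2) - (expectation (\<lambda>\<omega>. inner (X \<omega>) f))\<^sup>2"
    and "0 \<le> inner (cov_operator M X f) f"
proof -
  have int_norm: "integrable M (\<lambda>\<omega>. norm (X \<omega>))"
    by (rule square_integrable_imp_integrable[OF _ sq]) measurable
  then show int: "integrable M X"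
    by (rule integrable_norm_cancel) measurable
  have int_f: "integrable M (\<lambda>\<omega>. inner (X \<omega>) f)"
    using int by simp
  show int_f2: "integrable M (\<lambda>\<omega>. (inner (X \<omega>) f)\<^sup>2)"
  proof (rule Bochner_Integration.integrable_bound)
    show "integrable M (\<lambda>\<omega>. (norm f)\<^sup>2 * (norm (X \<omega>))\<^sup>2)" using sq by simp
    show "AE \<omega> in M. norm ((inner (X \<omega>) f)\<^sup>2) \<le> norm ((norm f)\<^sup>2 * (norm (X \<omega>))\<^sup>2)"
    proof (rule AE_I2)
      fix \<omega>
      have "\<bar>inner (X \<omega>) f\<bar>\<^sup>2 \<le> (norm (X \<omega>) * norm f)\<^sup>2"
        by (intro power_mono Cauchy_Schwarz_ineq2) simp
      then show "norm ((inner (X \<omega>) f)\<^sup>2) \<le> norm ((norm f)\<^sup>2 * (norm (X \<omega>))\<^sup>2)"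
        by (simp add: power_mult_distrib mult.commute)
    qed
  qed measurable
  define \<mu> where "\<mu> = integral\<^sup>L M X"
  have \<mu>: "inner \<mu> f = expectation (\<lambda>\<omega>. inner (X \<omega>) f)"
    unfolding \<mu>_def using int by (simp add: integral_inner_left)
  \<comment> \<open>\<open>mean_element\<close> is a definite description; integrability is what
    allows the one inside \<open>cov_operator\<close> to be evaluated as an integral.\<close>
  have intc: "integrable M (\<lambda>\<omega>. inner (X \<omega> - \<mu>) f *\<^sub>R X \<omega>)"
  proof (rule Bochner_Integration.integrable_bound)
    show "integrable M (\<lambda>\<omega>. norm f * ((norm (X \<omega>))\<^sup>2 + norm \<mu> * norm (X \<omega>)))"
      using sq int_norm by simp
    show "AE \<omega> in M. norm (inner (X \<omega> - \<mu>) f *\<^sub>R X \<omega>) \<le> norm (norm f * ((norm (X \<omega>))\<^sup>2 + norm \<mu> * norm (X \<omega>)))"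
    proof (rule AE_I2)
      fix \<omega>
      have "\<bar>inner (X \<omega> - \<mu>) f\<bar> \<le> (norm (X \<omega>) + norm \<mu>) * norm f"
        using Cauchy_Schwarz_ineq2[of "X \<omega> - \<mu>" f] norm_triangle_ineq4[of "X \<omega>" \<mu>]
        by (meson mult_right_mono norm_ge_zero order_trans)
      then have "\<bar>inner (X \<omega> - \<mu>) f\<bar> * norm (X \<omega>) \<le> (norm (X \<omega>) + norm \<mu>) * norm f * norm (X \<omega>)"
        by (rule mult_right_mono) simp
      also have "\<dots> = norm f * ((norm (X \<omega>))\<^sup>2 + norm \<mu> * norm (X \<omega>))"
        by (simp add: power2_eq_square algebra_simps)
      finally show "norm (inner (X \<omega> - \<mu>) f *\<^sub>R X \<omega>) \<le> norm (norm f * ((norm (X \<omega>))\<^sup>2 + norm \<mu> * norm (X \<omega>)))"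
        by simp
    qed
  qed measurable
  have "inner (cov_operator M X f) f = inner (expectation (\<lambda>\<omega>. inner (X \<omega> - \<mu>) f *\<^sub>R X \<omega>)) f"
    unfolding cov_operator_def mean_element_eq_integral[OF int] \<mu>_def[symmetric]
    by (simp only: mean_element_eq_integral[OF intc])
  also have "\<dots> = expectation (\<lambda>\<omega>. inner (inner (X \<omega> - \<mu>) f *\<^sub>R X \<omega>) f)"
    by (rule integral_inner_left[symmetric]) (rule intc)
  also have "\<dots> = expectation (\<lambda>\<omega>. (inner (X \<omega>) f)\<^sup>2 - inner \<mu> f * inner (X \<omega>) f)"
    by (simp add: inner_diff_left algebra_simps power2_eq_square)
  also have "\<dots> = expectation (\<lambda>\<omega>. (inner (X \<omega>) f)\<^sup>2) - (inner \<mu> f)\<^sup>2"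
    using int_f int_f2 by (simp add: \<mu> power2_eq_square)
  finally show eq: "inner (cov_operator M X f) f
      = expectation (\<lambda>\<omega>. (inner (X \<omega>) f)\<^sup>2) - (expectation (\<lambda>\<omega>. inner (X \<omega>) f))\<^sup>2"
    by (simp add: \<mu>)
  show "0 \<le> inner (cov_operator M X f) f"
    using variance_positive[of "\<lambda>\<omega>. inner (X \<omega>) f"]
    unfolding eq variance_eq[OF int_f int_f2] .
qed

lemma inner_sample_mean:
  "inner (sample_mean n x) f = (\<Sum>j=1..n. inner (x j) f) / n"
  by (simp add: sample_mean_def inner_sum_left)

text \<open>The kernel is a finite sum of products of a function of \<open>s\<close> and a function
  of \<open>t\<close>. Integrating out \<open>t\<close> turns the second factors into inner
  products, and the chosen representatives disappear.\<close>

lemma sample_cov_operator_eq: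
  "sample_cov_operator n x f =
    (1 / n) *\<^sub>R (\<Sum>j=1..n. inner (x j - sample_mean n x) f *\<^sub>R (x j - sample_mean n x))"
proof -
  define d where "d j t = l2_fun (x j) t - l2_fun (sample_mean n x) t" for j t
  have d: "sq_integrable (d j)" for j
    unfolding d_def by (intro sq_integrable_diff) simp_all
  have d_class: "l2_class (d j) = x j - sample_mean n x" for j
    using minus_l2.abs_eq[of "l2_fun (x j)" "l2_fun (sample_mean n x)"]
    by (simp add: d_def[abs_def])
  have d_int: "(LINT t|unit_leb. d j t * l2_fun f t) = inner (x j - sample_mean n x) f" for j
    using inner_l2.abs_eq[of "d j" "l2_fun f"] d by (simp add: d_class)
  define c where "c j = inner (x j - sample_mean n x) f / n" for j
  have "(LINT t|unit_leb. sample_cov_kernel n x s t * l2_fun f t) = (\<Sum>j=1..n. c j * d j s)" for s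
  proof -
    have "(LINT t|unit_leb. sample_cov_kernel n x s t * l2_fun f t)
        = (LINT t|unit_leb. (\<Sum>j=1..n. d j s / n * (d j t * l2_fun f t)))"
      by (simp add: sample_cov_kernel_def d_def sum_distrib_left sum_distrib_right mult.assoc)
    also have "\<dots> = (\<Sum>j=1..n. LINT t|unit_leb. d j s / n * (d j t * l2_fun f t))"
      by (intro Bochner_Integration.integral_sum integrable_mult_right sq_integrable_mult d) simp
    also have "\<dots> = (\<Sum>j=1..n. c j * d j s)"
      by (intro sum.cong refl) (simp only: integral_mult_right_zero d_int c_def, simp add: mult.commute)
    finally show ?thesis .
  qed
  then have "sample_cov_operator n x f = l2_class (\<lambda>s. \<Sum>j=1..n. c j * d j s)"
    by (simp add: sample_cov_operator_def)
  also have "\<dots> = (\<Sum>j=1..n. l2_class (\<lambda>s. c j * d j s))"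
    using l2_class_sum[of "{1..n}" "\<lambda>j s. c j * d j s"] d by (simp add: sq_integrable_scale)
  also have "\<dots> = (\<Sum>j=1..n. c j *\<^sub>R (x j - sample_mean n x))"
    using d by (simp flip: scaleR_l2.abs_eq d_class)
  finally show ?thesis
    by (simp add: c_def scaleR_sum_right)
qed

lemma inner_sample_cov_operator:
  shows "inner (sample_cov_operator n x f) f
      = (\<Sum>j=1..n. (inner (x j) f)\<^sup>2) / n - ((\<Sum>j=1..n. inner (x j) f) / n)\<^sup>2"
    and "0 \<le> inner (sample_cov_operator n x f) f"
proof -
  define m where "m = (\<Sum>j=1..n. inner (x j) f) / n"
  have eq: "inner (sample_cov_operator n x f) f = (\<Sum>j=1..n. (inner (x j) f - m)\<^sup>2) / n"
    by (simp add: sample_cov_operator_eq inner_sum_left inner_diff_left inner_sample_mean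
        m_def power2_eq_square)
  then show "0 \<le> inner (sample_cov_operator n x f) f"
    by (simp add: sum_nonneg)
  have "(\<Sum>j=1..n. (inner (x j) f - m)\<^sup>2)
      = (\<Sum>j=1..n. (inner (x j) f)\<^sup>2) - 2 * m * (\<Sum>j=1..n. inner (x j) f) + n * m\<^sup>2"
    by (simp add: power2_diff sum.distrib sum_subtractf sum_distrib_left mult_ac)
  also have "(\<Sum>j=1..n. inner (x j) f) = n * m"
    by (simp add: m_def)
  \<comment> \<open>The empty sample is separate: for \<open>n = 0\<close> division by zero makes
    both sides 0.\<close>
  finally show "inner (sample_cov_operator n x f) f
      = (\<Sum>j=1..n. (inner (x j) f)\<^sup>2) / n - ((\<Sum>j=1..n. inner (x j) f) / n)\<^sup>2"
    unfolding eq m_def[symmetric]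
    by (cases "n = 0") (simp add: m_def, simp add: field_simps power2_eq_square)
qed

section \<open>The characteristic functionals as functions of scalar averages\<close>

lemma norm_gauss_functional_le_1:
  "0 \<le> inner (K f) f \<Longrightarrow> cmod (gauss_functional f m K) \<le> 1"
  by (simp add: gauss_functional_def)

lemma norm_emp_char_functional_le_1:
  "cmod (emp_char_functional n x f) \<le> 1"
proof -
  have "cmod (\<Sum>j=1..n. exp (\<i> * complex_of_real (inner f (x j)))) \<le> (\<Sum>j=1..n. 1)"
    by (intro sum_norm_le) simp
  then show ?thesis
    by (simp add: emp_char_functional_def norm_mult norm_divide divide_le_eq)
qed

text \<open>The squared distance between \<open>Complex c s\<close> and the value at \<open>1\<close> of the characteristic function
  of a real normal law with first moment \<open>m\<close> and second moment \<open>q\<close>.\<close>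

definition gauss_discrepancy :: "real \<Rightarrow> real \<Rightarrow> real \<Rightarrow> real \<Rightarrow> real" where
  "gauss_discrepancy c s m q =
     (c - exp ((m\<^sup>2 - q) / 2) * cos m)\<^sup>2 + (s - exp ((m\<^sup>2 - q) / 2) * sin m)\<^sup>2"

text \<open>With variance \<open>q - m\<^sup>2\<close>, the exponent has real part
  \<open>(m\<^sup>2 - q) / 2\<close> and imaginary part \<open>m\<close>. The assumption concerns
  \<open>K\<close> only at the given \<open>f\<close>, so the lemma serves
  \<open>sample_cov_operator\<close> and \<open>cov_operator\<close> alike.\<close>

lemma norm_diff_gauss_functional_power2:
  assumes "inner (K f) f = q - (inner m f)\<^sup>2"
  shows "(cmod (z - gauss_functional f m K))\<^sup>2
    = gauss_discrepancy (Re z) (Im z) (inner m f) q"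
proof -
  have "gauss_functional f m K = exp (Complex (((inner m f)\<^sup>2 - q) / 2) (inner m f))"
    unfolding gauss_functional_def assms
    by (rule arg_cong[where f=exp]) (simp add: complex_eq_iff minus_divide_left)
  then show ?thesis
    by (simp add: gauss_discrepancy_def cmod_power2 Re_exp Im_exp)
qed

lemma emp_minus_gauss_functional_power2:
  "(cmod (emp_char_functional n x f
      - gauss_functional f (sample_mean n x) (sample_cov_operator n x)))\<^sup>2
    = gauss_discrepancy
     ((\<Sum>j=1..n. cos (inner (x j) f)) / n) ((\<Sum>j=1..n. sin (inner (x j) f)) / n)
     ((\<Sum>j=1..n. inner (x j) f) / n) ((\<Sum>j=1..n. (inner (x j) f)\<^sup>2) / n)"
proof -
  have "emp_char_functional n x f =
      Complex ((\<Sum>j=1..n. cos (inner (x j) f)) / n) ((\<Sum>j=1..n. sin (inner (x j) f)) / n)"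
    by (simp add: emp_char_functional_def complex_eq_iff Re_exp Im_exp inner_commute)
  moreover have "inner (sample_cov_operator n x f) f =
      (\<Sum>j=1..n. (inner (x j) f)\<^sup>2) / n - (inner (sample_mean n x) f)\<^sup>2"
    by (simp only: inner_sample_cov_operator(1) inner_sample_mean)
  ultimately show ?thesis
    by (simp only: norm_diff_gauss_functional_power2 complex.sel inner_sample_mean)
qed

text \<open>Both functionals have modulus at most 1, the Gaussian one because an empirical variance
  is nonnegative; thus 4 is \<open>(1 + 1)\<^sup>2\<close>, whatever the sample.\<close>

lemma emp_minus_gauss_functional_power2_le_4:
  "(cmod (emp_char_functional n x f
      - gauss_functional f (sample_mean n x) (sample_cov_operator n x)))\<^sup>2 \<le> 4"
proof -
  have "cmod (emp_char_functional n x f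
      - gauss_functional f (sample_mean n x) (sample_cov_operator n x)) \<le> 1 + 1"
    using norm_emp_char_functional_le_1[of n x f]
      norm_gauss_functional_le_1[of "sample_cov_operator n x" f "sample_mean n x"]
      inner_sample_cov_operator(2)[of n x f]
    by (intro norm_triangle_le_diff add_mono) simp_all
  from power_mono[OF this, of 2] show ?thesis by simp
qed

lemma (in prob_space) char_functional_eq:
  assumes [measurable]: "X \<in> borel_measurable M"
  shows "char_functional M X f =
    Complex (expectation (\<lambda>\<omega>. cos (inner (X \<omega>) f))) (expectation (\<lambda>\<omega>. sin (inner (X \<omega>) f)))"
proof -
  have "integrable M (\<lambda>\<omega>. exp (\<i> * complex_of_real (inner (X \<omega>) f)))"
    by (rule integrable_const_bound[where B=1]) auto
  from integral_Re[OF this] integral_Im[OF this] show ?thesis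
    by (simp add: char_functional_def complex_eq_iff Re_exp Im_exp)
qed

lemma (in prob_space) tau_eq:
  assumes X: "X \<in> borel_measurable M" "integrable M (\<lambda>\<omega>. (norm (X \<omega>))\<^sup>2)"
  shows "tau Q M X = (LINT f|Q. gauss_discrepancy
     (expectation (\<lambda>\<omega>. cos (inner (X \<omega>) f))) (expectation (\<lambda>\<omega>. sin (inner (X \<omega>) f)))
     (expectation (\<lambda>\<omega>. inner (X \<omega>) f)) (expectation (\<lambda>\<omega>. (inner (X \<omega>) f)\<^sup>2)))"
proof -
  have "inner (mean_element M X) f = expectation (\<lambda>\<omega>. inner (X \<omega>) f)" for f
    using inner_cov_operator(1)[OF X] by (simp add: mean_element_eq_integral integral_inner_left)
  moreover have "inner (cov_operator M X f) f = expectation (\<lambda>\<omega>. (inner (X \<omega>) f)\<^sup>2)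
      - (inner (mean_element M X) f)\<^sup>2" for f
    by (simp only: inner_cov_operator(3)[OF X] calculation)
  ultimately show ?thesis
    unfolding tau_def char_functional_eq[OF X(1)]
    by (simp only: norm_diff_gauss_functional_power2 complex.sel)
qed

text \<open>With countable quantifiers only, the set of pairs (\<omega>, f) at which the integrands
  converge is visibly measurable in the product, as the exchange of the almost-everywhere
  quantifiers requires.\<close>

lemma LIMSEQ_iff_inverse_Suc:
  fixes u :: "nat \<Rightarrow> real"
  shows "u \<longlonglongrightarrow> l \<longleftrightarrow> (\<forall>k. \<exists>m. \<forall>n\<ge>m. \<bar>u n - l\<bar> < inverse (Suc k))"
proof
  assume "u \<longlonglongrightarrow> l"
  from LIMSEQ_D[OF this] show "\<forall>k. \<exists>m. \<forall>n\<ge>m. \<bar>u n - l\<bar> < inverse (Suc k)"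
    by simp
next
  assume R: "\<forall>k. \<exists>m. \<forall>n\<ge>m. \<bar>u n - l\<bar> < inverse (Suc k)"
  show "u \<longlonglongrightarrow> l"
  proof (rule LIMSEQ_I)
    fix e :: real assume "0 < e"
    then obtain k where "inverse (Suc k) < e" using reals_Archimedean by blast
    with R show "\<exists>m. \<forall>n\<ge>m. norm (u n - l) < e"
      by (metis less_trans real_norm_def)
  qed
qed

theorem theorem4p1:
  fixes M :: "'w measure" and N :: "'v measure" and Q :: "l2 measure"
    and Xs :: "nat \<Rightarrow> 'w \<Rightarrow> l2" and X :: "'v \<Rightarrow> l2"
  assumes "prob_space Q" and "sets Q = sets borel"
    and "distr Q borel uminus = Q"
    and "prob_space N" and "X \<in> borel_measurable N"
    and "integrable N (\<lambda>\<omega>. (norm (X \<omega>))\<^sup>2)"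
    and "prob_space M"
    and "prob_space.indep_vars M (\<lambda>_. borel) Xs {1..}"
    and "\<And>j. j \<ge> 1 \<Longrightarrow> distr M borel (Xs j) = distr N borel X"
  shows "AE \<omega> in M. (\<lambda>n. T_stat Q n (\<lambda>j. Xs j \<omega>)) \<longlonglongrightarrow> tau Q N X"
proof -
  interpret Q: prob_space Q by fact
  interpret N: prob_space N by fact
  interpret M: prob_space M by fact
  interpret MQ: pair_prob_space M Q ..
  note [measurable_cong] = assms(2)
  note [measurable] = assms(5)
  \<comment> \<open>Nothing is assumed about \<open>Xs 0\<close>, so measurability is supplied for
    sample indices only.\<close>
  have Xs: "Xs j \<in> borel_measurable M" if "j \<in> {1..n}" for j n
    using assms(8) that by (auto simp: M.indep_vars_def)
  define avg where "avg h n \<omega> f = (\<Sum>j=1..n. h (inner (Xs j \<omega>) f)) / n"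
    for h :: "real \<Rightarrow> real" and n \<omega> f
  define E where "E h f = N.expectation (\<lambda>\<omega>. h (inner (X \<omega>) f))"
    for h :: "real \<Rightarrow> real" and f
  define G where "G n \<omega> f = gauss_discrepancy (avg cos n \<omega> f) (avg sin n \<omega> f)
    (avg (\<lambda>y. y) n \<omega> f) (avg (\<lambda>y. y\<^sup>2) n \<omega> f)" for n \<omega> f
  have G_eq: "G n \<omega> f = (cmod (emp_char_functional n (\<lambda>j. Xs j \<omega>) f
      - gauss_functional f (sample_mean n (\<lambda>j. Xs j \<omega>)) (sample_cov_operator n (\<lambda>j. Xs j \<omega>))))\<^sup>2" for n \<omega> f
    by (simp only: G_def avg_def emp_minus_gauss_functional_power2)
  define g where "g f = gauss_discrepancy (E cos f) (E sin f) (E (\<lambda>y. y) f) (E (\<lambda>y. y\<^sup>2) f)" for f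
  have avg_meas: "(\<lambda>p. avg h n (fst p) (snd p)) \<in> borel_measurable (M \<Otimes>\<^sub>M Q)"
    if [measurable]: "h \<in> borel_measurable borel" for h n
  proof -
    have "(\<lambda>p. h (inner (Xs j (fst p)) (snd p))) \<in> borel_measurable (M \<Otimes>\<^sub>M Q)" if "j \<in> {1..n}" for j
    proof -
      note [measurable] = Xs[OF that]
      show ?thesis by measurable
    qed
    then show ?thesis
      unfolding avg_def by (intro borel_measurable_divide borel_measurable_sum) auto
  qed
  have G_meas[measurable]: "(\<lambda>p. G n (fst p) (snd p)) \<in> borel_measurable (M \<Otimes>\<^sub>M Q)" for n
  proof -
    note [measurable] = avg_meas
    show ?thesis unfolding G_def gauss_discrepancy_def by measurable
  qed
  have E_meas[measurable]: "E h \<in> borel_measurable Q" if [measurable]: "h \<in> borel_measurable borel" for h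
    unfolding E_def by measurable
  have g_meas[measurable]: "g \<in> borel_measurable Q"
    unfolding g_def gauss_discrepancy_def by measurable
  have avg_lim: "AE \<omega> in M. (\<lambda>n. avg h n \<omega> f) \<longlonglongrightarrow> E h f"
    if [measurable]: "h \<in> borel_measurable borel" and int: "integrable N (\<lambda>\<omega>. h (inner (X \<omega>) f))" for h f
    unfolding avg_def E_def
    by (rule M.strong_law_of_large_numbers_functional[where h="\<lambda>x. h (inner x f)", OF assms(8,9,5) _ int])
      measurable
  have "AE \<omega> in M. (\<lambda>n. G n \<omega> f) \<longlonglongrightarrow> g f" for f
  proof -
    have "AE \<omega> in M. (\<lambda>n. avg cos n \<omega> f) \<longlonglongrightarrow> E cos f"
      "AE \<omega> in M. (\<lambda>n. avg sin n \<omega> f) \<longlonglongrightarrow> E sin f"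
      by (intro avg_lim N.integrable_const_bound[where B=1]; simp)+
    moreover have "AE \<omega> in M. (\<lambda>n. avg (\<lambda>y. y) n \<omega> f) \<longlonglongrightarrow> E (\<lambda>y. y) f"
      using N.inner_cov_operator(1)[OF assms(5,6)] by (intro avg_lim) simp_all
    moreover have "AE \<omega> in M. (\<lambda>n. avg (\<lambda>y. y\<^sup>2) n \<omega> f) \<longlonglongrightarrow> E (\<lambda>y. y\<^sup>2) f"
      using N.inner_cov_operator(2)[OF assms(5,6)] by (intro avg_lim) simp_all
    ultimately show ?thesis
      unfolding G_def g_def gauss_discrepancy_def
      by eventually_elim (intro tendsto_intros; simp)
  qed
  then have "AE f in Q. AE \<omega> in M. (\<lambda>n. G n \<omega> f) \<longlonglongrightarrow> g f"
    by simp
  moreover have "{p \<in> space (M \<Otimes>\<^sub>M Q). (\<lambda>n. G n (fst p) (snd p)) \<longlonglongrightarrow> g (snd p)} \<in> sets (M \<Otimes>\<^sub>M Q)"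
  proof -
    have "(\<lambda>n. G n (fst p) (snd p)) \<longlonglongrightarrow> g (snd p) \<longleftrightarrow>
        (\<forall>k. \<exists>m. \<forall>n\<ge>m. \<bar>G n (fst p) (snd p) - g (snd p)\<bar> < inverse (Suc k))" for p
      by (rule LIMSEQ_iff_inverse_Suc)
    then show ?thesis by simp
  qed
  ultimately have "AE \<omega> in M. AE f in Q. (\<lambda>n. G n \<omega> f) \<longlonglongrightarrow> g f"
    using MQ.AE_commute[of "\<lambda>\<omega> f. (\<lambda>n. G n \<omega> f) \<longlonglongrightarrow> g f"] by blast
  \<comment> \<open>Membership of \<omega> in \<open>space M\<close> makes the sections
    \<open>G n \<omega>\<close> of the jointly measurable functions measurable.\<close>
  with AE_space show ?thesis
  proof eventually_elim
    case (elim \<omega>)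
    have [measurable]: "G n \<omega> \<in> borel_measurable Q" for n
      using measurable_compose[OF measurable_Pair1'[OF elim(1)] G_meas[of n]] by simp
    have "(\<lambda>n. LINT f|Q. G n \<omega> f) \<longlonglongrightarrow> (LINT f|Q. g f)"
    proof (rule integral_dominated_convergence[where w="\<lambda>_. 4"])
      have "norm (G n \<omega> f) \<le> 4" for n f
        using emp_minus_gauss_functional_power2_le_4[of n "\<lambda>j. Xs j \<omega>" f] by (simp add: G_eq)
      then show "AE f in Q. norm (G n \<omega> f) \<le> 4" for n by simp
    qed (use elim in simp_all)
    then show ?case
      by (simp only: T_stat_def N.tau_eq[OF assms(5,6)] G_eq g_def E_def)
  qed
qed

end
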